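(* There is an algorithm that, given a finite simple graph $G$ with $n$ vertices and an integer $d$, constructs in time polynomial in $n+d$ a propositional formula $F(G,d)$ in conjunctive normal form which is satisfiable if and only if $\operatorname{tww}(G)\le d$.
   Context: Twin-width: a trigraph is a graph whose edges are coloured black or red (an ordinary graph has all edges black); $N(v)$ is the set of all neighbours of $v$. Contracting distinct (not necessarily adjacent) vertices $u,v$ replaces them by a new vertex $w$: vertices in $N(u)\triangle N(v)$ (other than $u,v$) become red neighbours of $w$; $x\in N(u)\cap N(v)$ becomes a black neighbour of $w$ if both $xu,xv$ are black, else a red neighbour; other edges are unchanged. A $d$-sequence of an $n$-vertex graph $G$ is a sequence $G_0=G,\dots,G_{n-1}$ of trigraphs, each obtained from the previous by one contraction, $G_{n-1}$ a single vertex, in which every vertex of every $G_i$ has at most $d$ red neighbours. The twin-width $\operatorname{tww}(G)$ is the least $d$ for which $G$ admits a $d$-sequence. *)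

theory Defs
  imports
    "Graph_Theory.Pair_Digraph"
    "HOL-Computational_Algebra.Polynomial"
begin

section \<open>Trigraphs and twin-width\<close>

text \<open>Both edge relations are kept symmetric. A finite simple graph is a \<open>pair_graph\<close> of the
  library, whose arc relation is symmetric and irreflexive.\<close>

record 'a trigraph =
  tverts :: "'a set"
  black :: "('a \<times> 'a) set"
  red :: "('a \<times> 'a) set"

definition trigraph_of_graph :: "'a pair_pre_digraph \<Rightarrow> 'a trigraph" where
  "trigraph_of_graph G = \<lparr> tverts = pverts G, black = parcs G, red = {} \<rparr>"

definition nbrs :: "'a trigraph \<Rightarrow> 'a \<Rightarrow> 'a set" where
  "nbrs T v = {x. (v, x) \<in> black T \<union> red T}"

definition red_nbrs :: "'a trigraph \<Rightarrow> 'a \<Rightarrow> 'a set" where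
  "red_nbrs T v = {x. (v, x) \<in> red T}"

definition contract :: "'a trigraph \<Rightarrow> 'a \<Rightarrow> 'a \<Rightarrow> 'a \<Rightarrow> 'a trigraph" where
  "contract T u v w =
    (let B = {x \<in> nbrs T u \<inter> nbrs T v. (x, u) \<in> black T \<and> (x, v) \<in> black T};
         R = (((nbrs T u - nbrs T v) \<union> (nbrs T v - nbrs T u)) - {u, v})
             \<union> {x \<in> nbrs T u \<inter> nbrs T v. \<not> ((x, u) \<in> black T \<and> (x, v) \<in> black T)};
         keep = (tverts T - {u, v}) \<times> (tverts T - {u, v})
     in \<lparr> tverts = insert w (tverts T - {u, v}),
          black = (black T \<inter> keep) \<union> {w} \<times> B \<union> B \<times> {w},
          red = (red T \<inter> keep) \<union> {w} \<times> R \<union> R \<times> {w} \<rparr>)"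

definition contraction :: "'a trigraph \<Rightarrow> 'a trigraph \<Rightarrow> bool" where
  "contraction T T' \<longleftrightarrow>
     (\<exists>u v w. u \<in> tverts T \<and> v \<in> tverts T \<and> u \<noteq> v \<and> w \<notin> tverts T \<and> T' = contract T u v w)"

definition d_sequence :: "nat \<Rightarrow> 'a pair_pre_digraph \<Rightarrow> 'a trigraph list \<Rightarrow> bool" where
  "d_sequence d G S \<longleftrightarrow>
     S \<noteq> [] \<and> length S = card (pverts G) \<and>
     hd S = trigraph_of_graph G \<and>
     (\<forall>i. Suc i < length S \<longrightarrow> contraction (S ! i) (S ! Suc i)) \<and>
     card (tverts (last S)) = 1 \<and>
     (\<forall>T \<in> set S. \<forall>v \<in> tverts T. card (red_nbrs T v) \<le> d)"

text \<open>Contractions need fresh vertices, so \<open>tww\<close> is meant for infinite vertex types, and for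
  nonempty graphs.\<close>

definition tww :: "'a pair_pre_digraph \<Rightarrow> nat" where
  "tww G = (LEAST d. \<exists>S. d_sequence d G S)"


section \<open>Formulas in conjunctive normal form\<close>

datatype literal = Pos nat | Neg nat

type_synonym cnf = "literal list list"

fun lit_holds :: "(nat \<Rightarrow> bool) \<Rightarrow> literal \<Rightarrow> bool" where
  "lit_holds \<alpha> (Pos i) = \<alpha> i"
| "lit_holds \<alpha> (Neg i) = (\<not> \<alpha> i)"

definition satisfiable :: "cnf \<Rightarrow> bool" where
  "satisfiable F \<longleftrightarrow> (\<exists>\<alpha>. \<forall>C \<in> set F. \<exists>l \<in> set C. lit_holds \<alpha> l)"

text \<open>The DIMACS format without its header line: variable \<open>i\<close> is written as the positive number
  \<open>i + 1\<close>, negation is the sign, and every clause is terminated by \<open>0\<close>.\<close>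

fun lit_code :: "literal \<Rightarrow> int" where
  "lit_code (Pos i) = int i + 1"
| "lit_code (Neg i) = - (int i + 1)"

definition dimacs :: "cnf \<Rightarrow> int list" where
  "dimacs F = concat (map (\<lambda>C. map lit_code C @ [0]) F)"


section \<open>Algorithms: programs for a unit-cost random access machine\<close>

text \<open>The machine has finitely many named registers, an integer memory with indirect addressing and
  a write-only output tape. Its only arithmetic operations are addition and subtraction, so the
  numbers arising in \<open>t\<close> steps have \<open>O(t)\<close> more bits than those in the input and the program.
  Hence polynomial time under the unit-cost measure is the same as polynomial time on Turing
  machines; this would fail with multiplication as a unit-cost operation. A command is charged
  one step whatever its expressions are, which for a fixed program is correct up to a constant
  factor. The output is written one number per step, so that its length is bounded by the running
  time.\<close>

datatype aexp = Const int | Reg string | Mem aexp | Add aexp aexp | Sub aexp aexp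

datatype bexp = Less aexp aexp | Equal aexp aexp | Not bexp | And bexp bexp

datatype com =
    Skip
  | Assign string aexp
  | Store aexp aexp
  | Emit aexp
  | Seq com com
  | If bexp com com
  | While bexp com

record state =
  reg :: "string \<Rightarrow> int"
  mem :: "int \<Rightarrow> int"
  out :: "int list"

primrec aval :: "aexp \<Rightarrow> state \<Rightarrow> int" where
  "aval (Const k) s = k"
| "aval (Reg x) s = reg s x"
| "aval (Mem a) s = mem s (aval a s)"
| "aval (Add a b) s = aval a s + aval b s"
| "aval (Sub a b) s = aval a s - aval b s"

primrec bval :: "bexp \<Rightarrow> state \<Rightarrow> bool" where
  "bval (Less a b) s = (aval a s < aval b s)"
| "bval (Equal a b) s = (aval a s = aval b s)"
| "bval (Not b) s = (\<not> bval b s)"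
| "bval (And b c) s = (bval b s \<and> bval c s)"

text \<open>\<open>runs c s t s'\<close>: started in \<open>s\<close>, the program \<open>c\<close> halts in \<open>s'\<close> after exactly \<open>t\<close> steps.\<close>

inductive runs :: "com \<Rightarrow> state \<Rightarrow> nat \<Rightarrow> state \<Rightarrow> bool" where
  Skip: "runs Skip s 1 s"
| Assign: "runs (Assign x a) s 1 (s\<lparr>reg := (reg s)(x := aval a s)\<rparr>)"
| Store: "runs (Store a b) s 1 (s\<lparr>mem := (mem s)(aval a s := aval b s)\<rparr>)"
| Emit: "runs (Emit a) s 1 (s\<lparr>out := out s @ [aval a s]\<rparr>)"
| Seq: "runs c s t s' \<Longrightarrow> runs c' s' t' s'' \<Longrightarrow> runs (Seq c c') s (t + t') s''"
| IfTrue: "bval b s \<Longrightarrow> runs c s t s' \<Longrightarrow> runs (If b c c') s (t + 1) s'"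
| IfFalse: "\<not> bval b s \<Longrightarrow> runs c' s t s' \<Longrightarrow> runs (If b c c') s (t + 1) s'"
| WhileFalse: "\<not> bval b s \<Longrightarrow> runs (While b c) s 1 s"
| WhileTrue: "bval b s \<Longrightarrow> runs c s t s' \<Longrightarrow> runs (While b c) s' t' s'' \<Longrightarrow>
    runs (While b c) s (t + t' + 1) s''"

inductive_cases runs_elims:
  "runs Skip s t s'" "runs (Assign x a) s t s'" "runs (Store a b) s t s'" "runs (Emit a) s t s'"
  "runs (Seq c c') s t s'" "runs (If b c c') s t s'"
inductive_cases runs_While_elim: "runs (While b c) s t s'"

lemma runs_deterministic:
  "runs c s t s' \<Longrightarrow> runs c s u s'' \<Longrightarrow> t = u \<and> s' = s''"
proof (induction arbitrary: u s'' rule: runs.induct)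
  case (Seq c s t s' c' t' s3)
  from Seq.prems show ?case by (rule runs_elims(5)) (metis Seq.IH)
next
  case (IfTrue b s c t s' c')
  from IfTrue.prems show ?case by (rule runs_elims(6)) (metis IfTrue.IH IfTrue.hyps(1) Suc_eq_plus1)+
next
  case (IfFalse b s c' t s' c)
  from IfFalse.prems show ?case by (rule runs_elims(6)) (metis IfFalse.IH IfFalse.hyps(1) Suc_eq_plus1)+
next
  case (WhileFalse b s c)
  from WhileFalse.prems show ?case by (rule runs_While_elim) (use WhileFalse.hyps in simp_all)
next
  case (WhileTrue b s c t s' t' s3)
  from WhileTrue.prems show ?case
    by (rule runs_While_elim) (metis WhileTrue.IH WhileTrue.hyps(1) Suc_eq_plus1)+
qed (erule runs_elims(1-4); simp)+

lemma runs_out_length: "runs c s t s' \<Longrightarrow> length (out s') \<le> length (out s) + t"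
  by (induction rule: runs.induct) auto

text \<open>The input: memory cell \<open>0\<close> holds the number \<open>n\<close> of vertices, cell \<open>1\<close> holds \<open>d\<close>, and the
  cells from \<open>2\<close> on hold the adjacency matrix row by row, with respect to an enumeration
  \<open>vs\<close> of the vertices.\<close>

definition input_list :: "nat list \<Rightarrow> nat pair_pre_digraph \<Rightarrow> int \<Rightarrow> int list" where
  "input_list vs G d =
     [int (length vs), d] @ concat (map (\<lambda>u. map (\<lambda>v. if (u, v) \<in> parcs G then 1 else 0) vs) vs)"

definition input_state :: "nat list \<Rightarrow> nat pair_pre_digraph \<Rightarrow> int \<Rightarrow> state" where
  "input_state vs G d =
     \<lparr> reg = (\<lambda>_. 0),
       mem = (\<lambda>a. if 0 \<le> a \<and> a < int (length (input_list vs G d))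
                  then input_list vs G d ! nat a else 0),
       out = [] \<rparr>"

end

theory Submission
  imports Defs
begin

text \<open>
  A contraction sequence is a sequence of partitions of the vertex set, each obtained from the
  previous one by merging two parts; two parts are joined by a red edge iff there are both an edge
  and a non-edge between them. Name every part by one of its vertices, its leader, so that step
  \<open>i\<close> merges the part of \<open>u i\<close> into the part of \<open>v i\<close>, after which \<open>u i\<close> never is a leader again.
  The formula guesses \<open>u\<close> and \<open>v\<close>, propagates the leaders, and gives each red neighbour of a part
  one of \<open>d\<close> slots, injectively. It suffices to propagate in one direction: superfluous true
  variables only make the remaining clauses harder to satisfy.

  The program is a nest of loops that print the clauses. It is written in a small language of loop
  nests whose programs run in polynomial time by construction.
\<close>

section \<open>Loop nests\<close>

text \<open>\<open>Mul x a g\<close> binds \<open>x\<close> to \<open>a\<close> times the number in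
  cell \<open>0\<close> while \<open>g\<close> runs: the machine cannot multiply, yet variable
  numbers and matrix addresses need products with \<open>n\<close>. No construct writes to memory,
  so loop bounds stay fixed.\<close>

datatype gen =
    Out aexp
  | Then gen gen  (infixr ";;" 60)
  | When bexp gen
  | For string int gen
  | Mul string aexp gen

primrec aregs :: "aexp \<Rightarrow> string set" where
  "aregs (Const k) = {}"
| "aregs (Reg x) = {x}"
| "aregs (Mem a) = aregs a"
| "aregs (Add a b) = aregs a \<union> aregs b"
| "aregs (Sub a b) = aregs a \<union> aregs b"

primrec bregs :: "bexp \<Rightarrow> string set" where
  "bregs (Less a b) = aregs a \<union> aregs b"
| "bregs (Equal a b) = aregs a \<union> aregs b"
| "bregs (Not b) = bregs b"
| "bregs (And b c) = bregs b \<union> bregs c"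

abbreviation set_reg :: "string \<Rightarrow> int \<Rightarrow> state \<Rightarrow> state" where
  "set_reg x v s \<equiv> s\<lparr>reg := (reg s)(x := v)\<rparr>"

primrec emitted :: "gen \<Rightarrow> state \<Rightarrow> int list" where
  "emitted (Out a) s = [aval a s]"
| "emitted (g ;; h) s = emitted g s @ emitted h s"
| "emitted (When b g) s = (if bval b s then emitted g s else [])"
| "emitted (For x c g) s = concat (map (\<lambda>k. emitted g (set_reg x (int k) s)) [0..<nat (mem s c)])"
| "emitted (Mul x a g) s = emitted g (set_reg x (aval a s * int (nat (mem s 0))) s)"

primrec compile :: "gen \<Rightarrow> com" where
  "compile (Out a) = Emit a"
| "compile (g ;; h) = Seq (compile g) (compile h)"
| "compile (When b g) = If b (compile g) Skip"
| "compile (For x c g) =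
     Seq (Assign x (Const 0))
       (While (Less (Reg x) (Mem (Const c)))
         (Seq (compile g) (Assign x (Add (Reg x) (Const 1)))))"
| "compile (Mul x a g) =
     Seq (Seq (Assign x (Const 0)) (Seq (Assign [] (Const 0))
       (While (Less (Reg []) (Mem (Const 0)))
         (Seq (Assign x (Add (Reg x) a)) (Assign [] (Add (Reg []) (Const 1)))))))
       (compile g)"

text \<open>The empty name is reserved for the counter of multiplication loops.\<close>

primrec well_scoped :: "string set \<Rightarrow> gen \<Rightarrow> bool" where
  "well_scoped X (Out a) \<longleftrightarrow> aregs a \<subseteq> X"
| "well_scoped X (g ;; h) \<longleftrightarrow> well_scoped X g \<and> well_scoped X h"
| "well_scoped X (When b g) \<longleftrightarrow> bregs b \<subseteq> X \<and> well_scoped X g"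
| "well_scoped X (For x c g) \<longleftrightarrow>
     x \<noteq> [] \<and> x \<notin> X \<and> c \<in> {0, 1} \<and> well_scoped (insert x X) g"
| "well_scoped X (Mul x a g) \<longleftrightarrow>
     x \<noteq> [] \<and> x \<notin> X \<and> aregs a \<subseteq> X \<and> well_scoped (insert x X) g"

text \<open>The indeterminate stands for a common bound on cells \<open>0\<close> and
  \<open>1\<close>. A loop round costs its body, the increment and the test; a round of
  multiplication costs two assignments and the test.\<close>

primrec time :: "gen \<Rightarrow> nat poly" where
  "time (Out a) = [:1:]"
| "time (g ;; h) = time g + time h"
| "time (When b g) = time g + [:2:]"
| "time (For x c g) = [:0, 1:] * (time g + [:2:]) + [:2:]"
| "time (Mul x a g) = time g + [:3, 3:]"

section \<open>Independence of the output from scratch registers\<close>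

text \<open>Outputs are not compared, and registers outside \<open>X\<close> may differ, since
  compiled loops leave their counters behind.\<close>

definition agree :: "string set \<Rightarrow> state \<Rightarrow> state \<Rightarrow> bool" where
  "agree X s s' \<longleftrightarrow> mem s = mem s' \<and> (\<forall>x\<in>X. reg s x = reg s' x)"

lemma agree_refl [simp]: "agree X s s"
  by (simp add: agree_def)

lemma agree_trans: "agree X s s' \<Longrightarrow> agree X s' s'' \<Longrightarrow> agree X s s''"
  by (simp add: agree_def)

lemma agree_mono: "agree X s s' \<Longrightarrow> Y \<subseteq> X \<Longrightarrow> agree Y s s'"
  by (auto simp: agree_def)

lemma agree_aval: "agree X s s' \<Longrightarrow> aregs a \<subseteq> X \<Longrightarrow> aval a s = aval a s'"
  by (induction a) (auto simp: agree_def)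

lemma agree_bval: "agree X s s' \<Longrightarrow> bregs b \<subseteq> X \<Longrightarrow> bval b s = bval b s'"
  by (induction b) (auto simp: agree_aval)

lemma agree_set_reg: "agree X s s' \<Longrightarrow> agree (insert x X) (set_reg x v s) (set_reg x v s')"
  by (auto simp: agree_def)

text \<open>A well-scoped nest reads only registers of \<open>X\<close> and those it has set itself.
  Hence what has run before does not influence what it prints.\<close>

lemma agree_emitted:
  "agree X s s' \<Longrightarrow> well_scoped X g \<Longrightarrow> emitted g s = emitted g s'"
proof (induction g arbitrary: X s s')
  case (For x c g)
  have "emitted g (set_reg x v s) = emitted g (set_reg x v s')" for v
    using For.IH[OF agree_set_reg[OF For.prems(1)]] For.prems(2) by simp
  moreover have "mem s = mem s'" using For.prems(1) by (simp add: agree_def)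
  ultimately show ?case by simp
next
  case (Mul x a g)
  have "emitted g (set_reg x v s) = emitted g (set_reg x v s')" for v
    using Mul.IH[OF agree_set_reg[OF Mul.prems(1)]] Mul.prems(2) by simp
  moreover have "mem s = mem s'" "aval a s = aval a s'"
    using Mul.prems agree_aval by (auto simp: agree_def)
  ultimately show ?case by simp
qed (auto dest: agree_aval agree_bval)

section \<open>Correctness and running time of compilation\<close>

text \<open>A loop rule with an invariant indexed by the number of completed rounds. Each round
  costs at most \<open>T\<close> plus the test; the last \<open>1\<close> is the failing
  test.\<close>

lemma While_count:
  assumes "\<And>k s. I k s \<Longrightarrow> k < m \<Longrightarrow> bval b s \<and> (\<exists>t s'. runs c s t s' \<and> t \<le> T \<and> I (Suc k) s')"
    and "\<And>s. I m s \<Longrightarrow> \<not> bval b s" and "I 0 s"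
  shows "\<exists>t s'. runs (While b c) s t s' \<and> t \<le> m * (T + 1) + 1 \<and> I m s'"
proof -
  \<comment> \<open>Induction on the number \<open>k\<close> of rounds still to come.\<close>
  have "k \<le> m \<Longrightarrow> I (m - k) s \<Longrightarrow>
    \<exists>t s'. runs (While b c) s t s' \<and> t \<le> k * (T + 1) + 1 \<and> I m s'" for k s
  proof (induction k arbitrary: s)
    case 0
    then show ?case using assms(2) WhileFalse by fastforce
  next
    case (Suc k)
    then have "m - Suc k < m" "Suc (m - Suc k) = m - k" by simp_all
    then obtain t s' where 1: "bval b s" "runs c s t s'" "t \<le> T" "I (m - k) s'"
      using assms(1)[OF Suc.prems(2)] by metis
    then obtain t' s'' where "runs (While b c) s' t' s''" "t' \<le> k * (T + 1) + 1" "I m s''"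
      using Suc.IH Suc.prems(1) by (metis Suc_leD)
    with 1 WhileTrue[OF 1(1,2)] show ?case
      by (intro exI[of _ "t + t' + 1"] exI[of _ s'']) auto
  qed
  from this[of m s] assms(3) show ?thesis by simp
qed

text \<open>The conclusion \<open>agree X s s'\<close> carries the induction through sequencing and
  loop rounds. A loop body is treated in the scope enlarged by its counter, so it leaves the counter
  unchanged.\<close>

theorem compile_correct:
  assumes "well_scoped X g" and "[] \<notin> X"
    and "nat (mem s 0) \<le> K" and "nat (mem s 1) \<le> K"
  shows "\<exists>t s'. runs (compile g) s t s' \<and> t \<le> poly (time g) K \<and>
    out s' = out s @ emitted g s \<and> agree X s s'"
  using assms
proof (induction g arbitrary: X s)
  case (Out a)
  show ?case by (simp, intro exI conjI, rule runs.Emit) (auto simp: agree_def)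
next
  case (Then g h)
  obtain t s' where 1: "runs (compile g) s t s'" "t \<le> poly (time g) K"
    "out s' = out s @ emitted g s" "agree X s s'"
    using Then.IH(1)[of X s] Then.prems by auto
  moreover have "mem s' = mem s" using 1(4) by (simp add: agree_def)
  then obtain t' s'' where 2: "runs (compile h) s' t' s''" "t' \<le> poly (time h) K"
    "out s'' = out s' @ emitted h s'" "agree X s' s''"
    using Then.IH(2)[of X s'] Then.prems by auto
  moreover have "emitted h s' = emitted h s"
    using agree_emitted[OF 1(4)] Then.prems by auto
  ultimately show ?case
    using runs.Seq[OF 1(1) 2(1)] agree_trans[OF 1(4) 2(4)]
    by (intro exI[of _ "t + t'"] exI[of _ s'']) auto
next
  case (When b g)
  show ?case
  proof (cases "bval b s")
    case True
    obtain t s' where "runs (compile g) s t s'" "t \<le> poly (time g) K"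
      "out s' = out s @ emitted g s" "agree X s s'"
      using When.IH[of X s] When.prems by auto
    then show ?thesis
      using True runs.IfTrue[OF True] by (intro exI[of _ "t + 1"] exI[of _ s']) auto
  next
    case False
    then show ?thesis
      using runs.IfFalse[OF False runs.Skip] by (intro exI[of _ "1 + 1"] exI[of _ s]) auto
  qed
next
  case (For x c g)
  let ?m = "nat (mem s c)"
  have m: "?m \<le> K" using For.prems by auto
  \<comment> \<open>The printed output is expressed through the initial state \<open>s\<close>;
    \<open>agree_emitted\<close> permits this although the current state has other scratch
    registers.\<close>
  define I where "I k r \<longleftrightarrow> agree X s r \<and> reg r x = int k \<and>
    out r = out s @ concat (map (\<lambda>k. emitted g (set_reg x (int k) s)) [0..<k])" for k r
  have "\<exists>t r. runs (While (Less (Reg x) (Mem (Const c)))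
         (Seq (compile g) (Assign x (Add (Reg x) (Const 1))))) (set_reg x 0 s) t r \<and>
         t \<le> ?m * (poly (time g) K + 1 + 1) + 1 \<and> I ?m r"
  proof (rule While_count)
    fix k r assume I: "I k r" and k: "k < ?m"
    have mem: "mem r = mem s" using I by (simp add: I_def agree_def)
    obtain t r' where 1: "runs (compile g) r t r'" "t \<le> poly (time g) K"
      "out r' = out r @ emitted g r" "agree (insert x X) r r'"
      using For.IH[of "insert x X" r] For.prems mem by auto
    have "agree (insert x X) r (set_reg x (int k) s)"
      using I by (auto simp: I_def agree_def)
    then have e: "emitted g r = emitted g (set_reg x (int k) s)"
      using agree_emitted For.prems(1) by fastforce
    have "I (Suc k) (set_reg x (reg r' x + 1) r')"
      using I 1(3,4) For.prems(1) e by (auto simp: I_def agree_def)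
    moreover have "runs (Seq (compile g) (Assign x (Add (Reg x) (Const 1)))) r (t + 1)
        (set_reg x (reg r' x + 1) r')"
      using runs.Seq[OF 1(1) runs.Assign[of x "Add (Reg x) (Const 1)"]] by simp
    ultimately show "bval (Less (Reg x) (Mem (Const c))) r \<and>
      (\<exists>t r'. runs (Seq (compile g) (Assign x (Add (Reg x) (Const 1)))) r t r' \<and>
         t \<le> poly (time g) K + 1 \<and> I (Suc k) r')"
      using I k mem 1(2) by (auto simp: I_def intro!: exI)
  next
    fix r assume "I ?m r"
    then show "\<not> bval (Less (Reg x) (Mem (Const c))) r" by (auto simp: I_def agree_def)
  next
    show "I 0 (set_reg x 0 s)" using For.prems(1) by (auto simp: I_def agree_def)
  qed
  then obtain t r where 1: "runs (While (Less (Reg x) (Mem (Const c)))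
         (Seq (compile g) (Assign x (Add (Reg x) (Const 1))))) (set_reg x 0 s) t r"
    "t \<le> ?m * (poly (time g) K + 1 + 1) + 1" "I ?m r" by blast
  have "runs (compile (For x c g)) s (1 + t) r"
    using runs.Seq[OF runs.Assign[of x "Const 0" s]] 1(1) by simp
  moreover have "?m * (poly (time g) K + 1 + 1) \<le> K * (poly (time g) K + 2)"
    using mult_le_mono1[OF m, of "poly (time g) K + 2"] by (simp only: add.assoc one_add_one)
  then have "1 + t \<le> poly (time (For x c g)) K" using 1(2) by (simp add: algebra_simps)
  ultimately show ?case using 1(3) by (auto simp: I_def)
next
  case (Mul x a g)
  let ?m = "nat (mem s 0)" and ?r = "set_reg [] 0 (set_reg x 0 s)"
  let ?body = "Seq (Assign x (Add (Reg x) a)) (Assign [] (Add (Reg []) (Const 1)))"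
  define v where "v = aval a s"
  define I where "I k r \<longleftrightarrow> agree X s r \<and> reg r [] = int k \<and> reg r x = int k * v \<and> out r = out s"
    for k r
  have "\<exists>t r. runs (While (Less (Reg []) (Mem (Const 0))) ?body) ?r t r \<and>
         t \<le> ?m * (2 + 1) + 1 \<and> I ?m r"
  proof (rule While_count)
    fix k r assume I: "I k r" and k: "k < ?m"
    \<comment> \<open>\<open>a\<close> reads only registers of \<open>X\<close>, and neither
      \<open>x\<close> nor the counter is among them, so the same summand \<open>v\<close> is added
      in every round.\<close>
    have "aval a r = v"
      using agree_aval[of X s r a] I Mul.prems(1) by (auto simp: I_def v_def)
    then have "runs ?body r (1 + 1) (set_reg [] (int k + 1) (set_reg x (int k * v + v) r))"
      using runs.Seq[OF runs.Assign[of x "Add (Reg x) a" r]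
          runs.Assign[of "[]" "Add (Reg []) (Const 1)"]] I Mul.prems(1)
      by (cases x) (simp_all add: I_def)
    moreover have "I (Suc k) (set_reg [] (int k + 1) (set_reg x (int k * v + v) r))"
      using I Mul.prems(1,2) by (auto simp: I_def agree_def algebra_simps)
    ultimately show "bval (Less (Reg []) (Mem (Const 0))) r \<and>
      (\<exists>t r'. runs ?body r t r' \<and> t \<le> 2 \<and> I (Suc k) r')"
      using I k by (auto simp: I_def agree_def intro!: exI)
  next
    fix r assume "I ?m r"
    then show "\<not> bval (Less (Reg []) (Mem (Const 0))) r" by (auto simp: I_def agree_def)
  next
    show "I 0 ?r" using Mul.prems(1,2) by (auto simp: I_def agree_def)
  qed
  then obtain t r where 1: "runs (While (Less (Reg []) (Mem (Const 0))) ?body) ?r t r"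
    "t \<le> ?m * (2 + 1) + 1" "I ?m r" by blast
  have mem: "mem r = mem s" using 1(3) by (simp add: I_def agree_def)
  then obtain t' r' where 2: "runs (compile g) r t' r'" "t' \<le> poly (time g) K"
    "out r' = out r @ emitted g r" "agree (insert x X) r r'"
    using Mul.IH[of "insert x X" r] Mul.prems by auto
  have "agree (insert x X) r (set_reg x (v * int ?m) s)"
    using 1(3) by (auto simp: I_def agree_def)
  then have e: "emitted g r = emitted g (set_reg x (v * int ?m) s)"
    using agree_emitted Mul.prems(1) by fastforce
  have "runs (compile (Mul x a g)) s ((1 + (1 + t)) + t') r'"
    using runs.Seq[OF runs.Seq[OF runs.Assign[of x "Const 0" s]
      runs.Seq[OF runs.Assign[of "[]" "Const 0"]]] 2(1)] 1(1) by simp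
  moreover have "1 + (1 + t) + t' \<le> poly (time (Mul x a g)) K"
    using 1(2) 2(2) Mul.prems(3) by simp
  moreover have "out r' = out s @ emitted (Mul x a g) s"
    using 1(3) 2(3) e by (simp add: I_def v_def)
  moreover have "agree X s r'"
    using 1(3) agree_mono[OF 2(4), of X] by (auto simp: I_def intro: agree_trans)
  ultimately show ?case by blast
qed

section \<open>Quotient trigraphs\<close>

text \<open>The fibres of \<open>h\<close> are the parts and its values their names. Used with
  \<open>a\<close> this detects an edge between two parts, used with the negation of
  \<open>a\<close> a non-edge, so one computation serves both.\<close>

definition meets :: "'b set \<Rightarrow> ('b \<Rightarrow> 'b \<Rightarrow> bool) \<Rightarrow> ('b \<Rightarrow> 'a) \<Rightarrow> 'a \<Rightarrow> 'a \<Rightarrow> bool" where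
  "meets V a h p q \<longleftrightarrow> p \<noteq> q \<and> (\<exists>x\<in>V. \<exists>y\<in>V. h x = p \<and> h y = q \<and> a x y)"

abbreviation mixed :: "'b set \<Rightarrow> ('b \<Rightarrow> 'b \<Rightarrow> bool) \<Rightarrow> ('b \<Rightarrow> 'a) \<Rightarrow> 'a \<Rightarrow> 'a \<Rightarrow> bool" where
  "mixed V a h p q \<equiv> meets V a h p q \<and> meets V (\<lambda>x y. \<not> a x y) h p q"

definition quotient_trigraph :: "'b set \<Rightarrow> ('b \<Rightarrow> 'b \<Rightarrow> bool) \<Rightarrow> ('b \<Rightarrow> 'a) \<Rightarrow> 'a trigraph" where
  "quotient_trigraph V a h = \<lparr> tverts = h ` V,
     black = {(p, q). meets V a h p q \<and> \<not> meets V (\<lambda>x y. \<not> a x y) h p q},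
     red = {(p, q). mixed V a h p q} \<rparr>"

lemma meets_commute: "symp a \<Longrightarrow> meets V a h p q \<longleftrightarrow> meets V a h q p"
  unfolding meets_def by (metis sympE)

lemma meets_vert: "meets V a h p q \<Longrightarrow> p \<in> h ` V" "meets V a h p q \<Longrightarrow> q \<in> h ` V"
  by (auto simp: meets_def)

text \<open>Parts named in the image are nonempty, and any pair of representatives is an edge or a
  non-edge.\<close>

lemma meets_or_not:
  "meets V a h p q \<or> meets V (\<lambda>x y. \<not> a x y) h p q \<longleftrightarrow> p \<in> h ` V \<and> q \<in> h ` V \<and> p \<noteq> q"
  unfolding meets_def by blast

text \<open>The name \<open>w\<close> is left open: contraction demands a fresh one, leaders demand
  one of \<open>u\<close> and \<open>v\<close>.\<close>

definition merge :: "'a \<Rightarrow> 'a \<Rightarrow> 'a \<Rightarrow> ('b \<Rightarrow> 'a) \<Rightarrow> 'b \<Rightarrow> 'a" where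
  "merge u v w h x = (if h x = u \<or> h x = v then w else h x)"

lemma merge_image:
  assumes "u \<in> h ` V" "v \<in> h ` V"
  shows "merge u v w h ` V = insert w (h ` V - {u, v})"
  using assms by (auto simp: merge_def image_iff)

text \<open>As \<open>w\<close> is fresh, its new fibre is the union of those of \<open>u\<close>
  and \<open>v\<close>, while names other than \<open>u\<close>, \<open>v\<close> and
  \<open>w\<close> keep theirs. Symmetry reduces \<open>q = w\<close> to
  \<open>p = w\<close>.\<close>

lemma meets_merge:
  assumes "w \<notin> h ` V" "symp a"
  shows "meets V a (merge u v w h) p q \<longleftrightarrow>
    (if p = w then q \<noteq> w \<and> q \<noteq> u \<and> q \<noteq> v \<and> (meets V a h u q \<or> meets V a h v q)
     else if q = w then p \<noteq> u \<and> p \<noteq> v \<and> (meets V a h u p \<or> meets V a h v p)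
     else p \<noteq> u \<and> p \<noteq> v \<and> q \<noteq> u \<and> q \<noteq> v \<and> meets V a h p q)"
proof -
  have mw: "merge u v w h x = w \<longleftrightarrow> h x = u \<or> h x = v" if "x \<in> V" for x
    using assms(1) that by (auto simp: merge_def)
  have mq: "merge u v w h x = q \<longleftrightarrow> h x = q \<and> q \<noteq> u \<and> q \<noteq> v" if "q \<noteq> w" for x q
    using that by (auto simp: merge_def)
  have A: "meets V a (merge u v w h) w q \<longleftrightarrow>
      q \<noteq> w \<and> (\<exists>x\<in>V. \<exists>y\<in>V. (h x = u \<or> h x = v) \<and> (h y = q \<and> q \<noteq> u \<and> q \<noteq> v) \<and> a x y)" for q
  proof (cases "q = w")
    case False
    show ?thesis unfolding meets_def mq[OF False] using False mw by auto
  qed (simp add: meets_def)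
  have 1: "meets V a (merge u v w h) w q \<longleftrightarrow>
      q \<noteq> w \<and> q \<noteq> u \<and> q \<noteq> v \<and> (meets V a h u q \<or> meets V a h v q)" for q
    unfolding A unfolding meets_def by auto
  have 2: "meets V a (merge u v w h) p q \<longleftrightarrow>
      p \<noteq> u \<and> p \<noteq> v \<and> q \<noteq> u \<and> q \<noteq> v \<and> meets V a h p q" if "p \<noteq> w" "q \<noteq> w" for p q
    unfolding meets_def mq[OF that(1)] mq[OF that(2)] by auto
  show ?thesis
    using 1 2 meets_commute[OF assms(2), of V "merge u v w h" p q] by auto
qed

lemma trigraph_eqI:
  assumes "tverts T = tverts T'" "\<And>p q. (p, q) \<in> black T \<longleftrightarrow> (p, q) \<in> black T'"
    "\<And>p q. (p, q) \<in> red T \<longleftrightarrow> (p, q) \<in> red T'"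
  shows "T = (T' :: 'a trigraph)"
proof (rule trigraph.equality)
  show "black T = black T'" using assms(2) by (intro set_eqI) (metis surj_pair)
  show "red T = red T'" using assms(3) by (intro set_eqI) (metis surj_pair)
qed (simp_all add: assms(1))

text \<open>The colours of a contraction are those of the quotient: a part joined to only one of the
  two merged parts has a non-edge to the other, by \<open>meets_or_not\<close>, and so is mixed
  towards their union.\<close>

lemma contract_quotient:
  assumes uv: "u \<in> h ` V" "v \<in> h ` V" "u \<noteq> v" and w: "w \<notin> h ` V" and a: "symp a"
  shows "contract (quotient_trigraph V a h) u v w = quotient_trigraph V a (merge u v w h)"
proof -
  let ?E = "meets V a h" and ?N = "meets V (\<lambda>x y. \<not> a x y) h"
  have na: "symp (\<lambda>x y. \<not> a x y)" using a by (auto simp: symp_def)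
  have E: "?E p q \<longleftrightarrow> ?E q p" and N: "?N p q \<longleftrightarrow> ?N q p" for p q
    by (rule meets_commute[OF a], rule meets_commute[OF na])
  have EN: "?E p q \<or> ?N p q \<longleftrightarrow> p \<in> h ` V \<and> q \<in> h ` V \<and> p \<noteq> q" for p q
    by (rule meets_or_not)
  have wE: "\<not> ?E w q" "\<not> ?E q w" "\<not> ?N w q" "\<not> ?N q w" for q
    using w EN by blast+
  have nw: "w \<noteq> u" "w \<noteq> v" using uv w by auto
  have nb: "nbrs (quotient_trigraph V a h) p = {q. ?E p q}" for p
    by (auto simp: nbrs_def quotient_trigraph_def)
  have bl: "(p, q) \<in> black (quotient_trigraph V a h) \<longleftrightarrow> ?E p q \<and> \<not> ?N p q" for p q
    by (simp add: quotient_trigraph_def)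
  have rd: "(p, q) \<in> red (quotient_trigraph V a h) \<longleftrightarrow> ?E p q \<and> ?N p q" for p q
    by (simp add: quotient_trigraph_def)
  have tv: "tverts (quotient_trigraph V a h) = h ` V" by (simp add: quotient_trigraph_def)
  note mE = meets_merge[OF w a, of u v] and mN = meets_merge[OF w na, of u v]
  have EV: "?E p q \<Longrightarrow> p \<in> h ` V \<and> q \<in> h ` V" for p q
    using EN by blast
  have ENu: "?E u q \<or> ?N u q \<longleftrightarrow> q \<in> h ` V \<and> u \<noteq> q" for q using EN[of u q] uv by simp
  have ENv: "?E v q \<or> ?N v q \<longleftrightarrow> q \<in> h ` V \<and> v \<noteq> q" for q using EN[of v q] uv by simp
  \<comment> \<open>The black and red neighbours of the new vertex, expressed by edges and non-edges
    alone.\<close>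
  define B where "B = {x. ?E u x \<and> ?E v x \<and> \<not> ?N u x \<and> \<not> ?N v x}"
  define R where "R = {x. x \<noteq> u \<and> x \<noteq> v \<and> (?E u x \<or> ?E v x) \<and> (?N u x \<or> ?N v x)}"
  have B: "{x \<in> nbrs (quotient_trigraph V a h) u \<inter> nbrs (quotient_trigraph V a h) v.
      (x, u) \<in> black (quotient_trigraph V a h) \<and> (x, v) \<in> black (quotient_trigraph V a h)} = B"
    unfolding nb bl B_def Int_iff mem_Collect_eq
    using E[of _ u] E[of _ v] N[of _ u] N[of _ v] by auto
  have R: "((nbrs (quotient_trigraph V a h) u - nbrs (quotient_trigraph V a h) v) \<union>
        (nbrs (quotient_trigraph V a h) v - nbrs (quotient_trigraph V a h) u)) - {u, v}
      \<union> {x \<in> nbrs (quotient_trigraph V a h) u \<inter> nbrs (quotient_trigraph V a h) v.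
      \<not> ((x, u) \<in> black (quotient_trigraph V a h) \<and> (x, v) \<in> black (quotient_trigraph V a h))} = R"
    (is "?L = R")
  proof (rule set_eqI)
    fix x
    show "x \<in> ?L \<longleftrightarrow> x \<in> R"
      unfolding nb bl R_def Un_iff Diff_iff Int_iff mem_Collect_eq insert_iff empty_iff
      using E[of x u] E[of x v] N[of x u] N[of x v] ENu[of x] ENv[of x] by argo
  qed
  have c: "contract (quotient_trigraph V a h) u v w = \<lparr> tverts = insert w (h ` V - {u, v}),
      black = (black (quotient_trigraph V a h) \<inter> (h ` V - {u, v}) \<times> (h ` V - {u, v})) \<union> {w} \<times> B \<union> B \<times> {w},
      red = (red (quotient_trigraph V a h) \<inter> (h ` V - {u, v}) \<times> (h ` V - {u, v})) \<union> {w} \<times> R \<union> R \<times> {w} \<rparr>"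
    unfolding contract_def Let_def B R tv by (rule refl)
  \<comment> \<open>This brings \<open>B\<close> and \<open>R\<close> into the form of
    \<open>meets_merge\<close> at \<open>p = w\<close>. For \<open>B\<close>, a part without
    non-edges to \<open>u\<close> and \<open>v\<close> has edges to both.\<close>
  have Bx: "x \<in> B \<longleftrightarrow> x \<noteq> u \<and> x \<noteq> v \<and> x \<noteq> w \<and> (?E u x \<or> ?E v x) \<and> \<not> (?N u x \<or> ?N v x)" for x
    unfolding B_def mem_Collect_eq using ENu[of x] ENv[of x] EV[of u x] w by metis
  have Rx: "x \<in> R \<longleftrightarrow> x \<noteq> u \<and> x \<noteq> v \<and> x \<noteq> w \<and> (?E u x \<or> ?E v x) \<and> (?N u x \<or> ?N v x)" for x
    unfolding R_def mem_Collect_eq using EV[of u x] EV[of v x] w by metis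
  show ?thesis
  proof (rule trigraph_eqI)
    show "tverts (contract (quotient_trigraph V a h) u v w) = tverts (quotient_trigraph V a (merge u v w h))"
      unfolding c using merge_image[OF uv(1,2)] by (simp add: quotient_trigraph_def)
  next
    fix p q
    have b: "black (contract (quotient_trigraph V a h) u v w) = (black (quotient_trigraph V a h) \<inter>
        (h ` V - {u, v}) \<times> (h ` V - {u, v})) \<union> {w} \<times> B \<union> B \<times> {w}"
      and r: "red (contract (quotient_trigraph V a h) u v w) = (red (quotient_trigraph V a h) \<inter>
        (h ` V - {u, v}) \<times> (h ` V - {u, v})) \<union> {w} \<times> R \<union> R \<times> {w}"
      by (simp_all add: c)
    have quot_black: "(p, q) \<in> black (quotient_trigraph V a (merge u v w h)) \<longleftrightarrow>
      meets V a (merge u v w h) p q \<and> \<not> meets V (\<lambda>x y. \<not> a x y) (merge u v w h) p q"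
      by (simp add: quotient_trigraph_def)
    have quot_red: "(p, q) \<in> red (quotient_trigraph V a (merge u v w h)) \<longleftrightarrow>
      meets V a (merge u v w h) p q \<and> meets V (\<lambda>x y. \<not> a x y) (merge u v w h) p q"
      by (simp add: quotient_trigraph_def)
    show "(p, q) \<in> black (contract (quotient_trigraph V a h) u v w) \<longleftrightarrow>
        (p, q) \<in> black (quotient_trigraph V a (merge u v w h))"
    proof -
      consider "p = w" | "p \<noteq> w" "q = w" | "p \<noteq> w" "q \<noteq> w" by blast
      then show ?thesis
      proof cases
        case 1
        then show ?thesis unfolding quot_black b by (simp add: mE mN bl Bx wE nw) blast
      next
        case 2
        then show ?thesis unfolding quot_black b by (simp add: mE mN bl Bx wE nw) blast
      next
        case 3
        then show ?thesis unfolding quot_black b using EV[of p q] by (simp add: mE mN bl Bx) blast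
      qed
    qed
    show "(p, q) \<in> red (contract (quotient_trigraph V a h) u v w) \<longleftrightarrow>
        (p, q) \<in> red (quotient_trigraph V a (merge u v w h))"
    proof -
      consider "p = w" | "p \<noteq> w" "q = w" | "p \<noteq> w" "q \<noteq> w" by blast
      then show ?thesis
      proof cases
        case 1
        then show ?thesis unfolding quot_red r by (simp add: mE mN rd Rx wE nw) blast
      next
        case 2
        then show ?thesis unfolding quot_red r by (simp add: mE mN rd Rx wE nw) blast
      next
        case 3
        then show ?thesis unfolding quot_red r using EV[of p q] by (simp add: mE mN rd Rx) blast
      qed
    qed
  qed
qed

section \<open>Renaming the parts of a partition\<close>

definition same_kernel :: "'b set \<Rightarrow> ('b \<Rightarrow> 'a) \<Rightarrow> ('b \<Rightarrow> 'c) \<Rightarrow> bool" where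
  "same_kernel V h g \<longleftrightarrow> (\<forall>x\<in>V. \<forall>y\<in>V. h x = h y \<longleftrightarrow> g x = g y)"

lemma red_nbrs_quotient: "red_nbrs (quotient_trigraph V a h) p = {q. mixed V a h p q}"
  by (simp add: red_nbrs_def quotient_trigraph_def)

lemma same_kernel_meets:
  assumes "same_kernel V h g" "x \<in> V" "y \<in> V"
  shows "meets V a h (h x) (h y) \<longleftrightarrow> meets V a g (g x) (g y)"
proof -
  have "h z = h x \<longleftrightarrow> g z = g x" "h z = h y \<longleftrightarrow> g z = g y" "h x = h y \<longleftrightarrow> g x = g y"
    if "z \<in> V" for z
    using assms that by (simp_all add: same_kernel_def)
  then show ?thesis using assms(2) by (simp add: meets_def cong: bex_cong)
qed

lemma same_kernel_card:
  assumes "same_kernel V h g" "S \<subseteq> V"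
  shows "card (h ` S) = card (g ` S)"
proof -
  \<comment> \<open>The renaming from \<open>h\<close> to \<open>g\<close>; the choice of
    representative is immaterial because the kernels agree.\<close>
  define k where "k p = g (inv_into S h p)" for p
  have k: "k (h x) = g x" if "x \<in> S" for x
  proof -
    have "inv_into S h (h x) \<in> S" "h (inv_into S h (h x)) = h x"
      using that by (simp_all add: inv_into_into f_inv_into_f)
    then show ?thesis
      using assms that unfolding same_kernel_def k_def by (meson subsetD)
  qed
  have "inj_on k (h ` S)"
  proof (rule inj_onI)
    fix p q assume "p \<in> h ` S" "q \<in> h ` S" and eq: "k p = k q"
    then obtain x y where xy: "x \<in> S" "p = h x" "y \<in> S" "q = h y" by blast
    then have "g x = g y" using eq k by simp
    then show "p = q" using assms xy unfolding same_kernel_def by (meson subsetD)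
  qed
  moreover have "k ` h ` S = g ` S" using k by (simp add: image_image)
  ultimately show ?thesis by (metis card_image)
qed

text \<open>In this form \<open>same_kernel_card\<close> applies, and red neighbourhoods over a
  finite ground set are visibly finite.\<close>

lemma red_nbrs_quotient_image:
  "red_nbrs (quotient_trigraph V a h) p = h ` {y \<in> V. mixed V a h p (h y)}"
proof -
  have "q \<in> h ` V" if "mixed V a h p q" for q
    using that meets_vert(2) by fast
  then show ?thesis unfolding red_nbrs_quotient by blast
qed

lemma same_kernel_red_degree:
  assumes "same_kernel V h g" "x \<in> V"
  shows "card (red_nbrs (quotient_trigraph V a h) (h x)) = card (red_nbrs (quotient_trigraph V a g) (g x))"
proof -
  have "{y \<in> V. mixed V a h (h x) (h y)} = {y \<in> V. mixed V a g (g x) (g y)}"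
    using same_kernel_meets[OF assms] by blast
  then show ?thesis
    using same_kernel_card[OF assms(1), of "{y \<in> V. mixed V a h (h x) (h y)}"]
    by (simp add: red_nbrs_quotient_image)
qed

section \<open>Twin-width in terms of leaders\<close>

text \<open>The conditions on \<open>w\<close> and \<open>w'\<close> exclude the name of a third
  part, which would be swallowed by the merge. They admit a fresh name on one side and a leader on
  the other.\<close>

lemma same_kernel_merge:
  assumes "same_kernel V h g" "x \<in> V" "y \<in> V"
    and "w \<in> h ` V \<longrightarrow> w = h x \<or> w = h y" "w' \<in> g ` V \<longrightarrow> w' = g x \<or> w' = g y"
  shows "same_kernel V (merge (h x) (h y) w h) (merge (g x) (g y) w' g)"
  unfolding same_kernel_def
proof (intro ballI)
  fix a b assume ab: "a \<in> V" "b \<in> V"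
  have k: "h a = h x \<longleftrightarrow> g a = g x" "h a = h y \<longleftrightarrow> g a = g y" "h b = h x \<longleftrightarrow> g b = g x"
    "h b = h y \<longleftrightarrow> g b = g y" "h a = h b \<longleftrightarrow> g a = g b"
    using assms(1-3) ab unfolding same_kernel_def by blast+
  have "h a = w \<Longrightarrow> h a = h x \<or> h a = h y" "h b = w \<Longrightarrow> h b = h x \<or> h b = h y"
    "g a = w' \<Longrightarrow> g a = g x \<or> g a = g y" "g b = w' \<Longrightarrow> g b = g x \<or> g b = g y"
    using assms(4,5) ab by blast+
  then show "merge (h x) (h y) w h a = merge (h x) (h y) w h b \<longleftrightarrow>
      merge (g x) (g y) w' g a = merge (g x) (g y) w' g b"
    unfolding merge_def using k by (smt (verit))
qed

text \<open>Index \<open>i\<close> refers to the partition before step \<open>i\<close>, starting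
  from singletons.\<close>

primrec leader :: "(nat \<Rightarrow> nat) \<Rightarrow> (nat \<Rightarrow> nat) \<Rightarrow> nat \<Rightarrow> nat \<Rightarrow> nat" where
  "leader u v 0 = (\<lambda>x. x)"
| "leader u v (Suc i) = merge (u i) (v i) (v i) (leader u v i)"

definition merges :: "nat \<Rightarrow> nat \<Rightarrow> (nat \<Rightarrow> nat) \<Rightarrow> (nat \<Rightarrow> nat) \<Rightarrow> bool" where
  "merges n m u v \<longleftrightarrow> (\<forall>i<m. u i < n \<and> v i < n \<and> u i \<notin> u ` {..<i} \<and> v i \<notin> u ` {..i})"

lemma mergesD:
  assumes "merges n m u v" "i < m"
  shows "u i < n" "v i < n" "u i \<notin> u ` {..<i}" "v i \<notin> u ` {..<i}" "u i \<noteq> v i"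
proof -
  have "u i < n \<and> v i < n \<and> u i \<notin> u ` {..<i} \<and> v i \<notin> u ` {..i}"
    using assms by (simp add: merges_def)
  moreover have "u ` {..i} = insert (u i) (u ` {..<i})" by (simp flip: lessThan_Suc_atMost add: lessThan_Suc)
  ultimately show "u i < n" "v i < n" "u i \<notin> u ` {..<i}" "v i \<notin> u ` {..<i}" "u i \<noteq> v i" by auto
qed

lemma leader_cong:
  "(\<And>j. j < i \<Longrightarrow> u j = u' j \<and> v j = v' j) \<Longrightarrow> leader u v i = leader u' v' i"
  by (induction i) simp_all

text \<open>Each step removes exactly \<open>u i\<close> from the set of leaders, so the sequence
  \<open>u\<close> alone determines which vertices still lead.\<close>

lemma leader_image:
  "merges n m u v \<Longrightarrow> i \<le> m \<Longrightarrow> leader u v i ` {..<n} = {..<n} - u ` {..<i}"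
proof (induction i)
  case (Suc i)
  have "u i \<in> leader u v i ` {..<n}" "v i \<in> leader u v i ` {..<n}" "u i \<noteq> v i"
    using Suc mergesD[OF Suc.prems(1), of i] by simp_all
  then show ?case using Suc by (auto simp: merge_image lessThan_Suc)
qed simp

lemma leader_fixed: "p \<notin> u ` {..<i} \<Longrightarrow> leader u v i p = p"
  by (induction i) (auto simp: merge_def lessThan_Suc)

text \<open>A full sequence has \<open>n - 1\<close> merges but \<open>n\<close> partitions, hence
  the range \<open>i < n\<close>.\<close>

definition red_bounded :: "nat \<Rightarrow> (nat \<Rightarrow> nat \<Rightarrow> bool) \<Rightarrow> nat \<Rightarrow> (nat \<Rightarrow> nat) \<Rightarrow> (nat \<Rightarrow> nat) \<Rightarrow> bool" where
  "red_bounded n a d u v \<longleftrightarrow> (\<forall>i<n. \<forall>x<n.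
     card (red_nbrs (quotient_trigraph {..<n} a (leader u v i)) (leader u v i x)) \<le> d)"

text \<open>All fibres are singletons, so no pair is mixed; the absence of loops matches the
  condition \<open>p \<noteq> q\<close> in \<open>meets\<close>.\<close>

lemma quotient_enum:
  assumes "pair_graph G" "distinct vs" "set vs = pverts G"
  shows "quotient_trigraph {..<length vs} (\<lambda>x y. (vs ! x, vs ! y) \<in> parcs G) ((!) vs) = trigraph_of_graph G"
proof -
  interpret pair_graph G by fact
  have arc: "x \<in> pverts G \<and> y \<in> pverts G \<and> x \<noteq> y" if "(x, y) \<in> parcs G" for x y
    using that arc_fst_in_verts arc_snd_in_verts no_loops' by fastforce
  have vs: "p \<in> pverts G \<longleftrightarrow> (\<exists>x<length vs. vs ! x = p)" for p
    using assms(3) by (metis in_set_conv_nth)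
  have E: "meets {..<length vs} (\<lambda>x y. (vs ! x, vs ! y) \<in> parcs G) ((!) vs) p q \<longleftrightarrow>
      (p, q) \<in> parcs G" for p q
    unfolding meets_def using arc[of p q] vs by auto
  have N: "meets {..<length vs} (\<lambda>x y. (vs ! x, vs ! y) \<notin> parcs G) ((!) vs) p q \<Longrightarrow>
      (p, q) \<notin> parcs G" for p q
    unfolding meets_def by auto
  have "(!) vs ` {..<length vs} = pverts G" using vs by auto
  then show ?thesis unfolding quotient_trigraph_def trigraph_of_graph_def E using N by auto
qed

section \<open>Passing between contraction sequences and merges of positions in the
  enumeration\<close>

locale enumerated_graph =
  fixes G :: "nat pair_pre_digraph" and vs :: "nat list"
  assumes graph: "pair_graph G" and nonempty: "pverts G \<noteq> {}"
    and vs: "distinct vs" "set vs = pverts G"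
begin

definition n :: nat where
  "n = length vs"

definition a :: "nat \<Rightarrow> nat \<Rightarrow> bool" where
  "a x y \<longleftrightarrow> (vs ! x, vs ! y) \<in> parcs G"

lemma n_card: "n = card (pverts G)"
  using vs distinct_card n_def by metis

lemma n_pos: "0 < n"
  using nonempty vs(2) n_def by auto

lemma a_sym: "symp a"
proof -
  interpret pair_graph G by (rule graph)
  show ?thesis unfolding a_def by (auto intro!: sympI arcs_symmetric)
qed

lemma initial: "quotient_trigraph {..<n} a ((!) vs) = trigraph_of_graph G"
  using quotient_enum[OF graph vs] by (simp add: a_def[abs_def] n_def)

lemma initial_kernel: "same_kernel {..<n} ((!) vs) (leader u v 0)"
  unfolding same_kernel_def n_def using vs(1) by (auto simp: nth_eq_iff_index_eq)

text \<open>The vertices of the given trigraphs have arbitrary names, so the induction tracks only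
  the kernel of a naming \<open>h\<close>.\<close>

lemma merges_of_contractions:
  assumes "S ! 0 = trigraph_of_graph G" and "\<And>i. i < m \<Longrightarrow> contraction (S ! i) (S ! Suc i)"
  shows "\<exists>u v. merges n m u v \<and>
    (\<forall>i\<le>m. \<exists>h. S ! i = quotient_trigraph {..<n} a h \<and> same_kernel {..<n} h (leader u v i))"
  using assms(2)
proof (induction m)
  case 0
  have "S ! 0 = quotient_trigraph {..<n} a ((!) vs) \<and> same_kernel {..<n} ((!) vs) (leader u v 0)" for u v
    using assms(1) initial initial_kernel by simp
  then show ?case unfolding merges_def by blast
next
  case (Suc m)
  then obtain u v where uv: "merges n m u v" and IH: "\<And>i. i \<le> m \<Longrightarrow>
      \<exists>h. S ! i = quotient_trigraph {..<n} a h \<and> same_kernel {..<n} h (leader u v i)"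
    by (metis less_SucI)
  obtain h where h: "S ! m = quotient_trigraph {..<n} a h" and ker: "same_kernel {..<n} h (leader u v m)"
    using IH by blast
  have "tverts (S ! m) = h ` {..<n}" using h by (simp add: quotient_trigraph_def)
  then obtain x y w where xy: "x < n" "y < n" "h x \<noteq> h y" and w: "w \<notin> h ` {..<n}"
    and S: "S ! Suc m = contract (S ! m) (h x) (h y) w"
    using Suc.prems[of m] unfolding contraction_def by auto
  let ?l = "leader u v m"
  \<comment> \<open>The contracted vertices name the parts of \<open>x\<close> and \<open>y\<close>;
    the leaders of these parts are recorded as step \<open>m\<close>, which leaves the leader maps
    up to index \<open>m\<close> unchanged.\<close>
  define u' v' where "u' = u(m := ?l x)" and "v' = v(m := ?l y)"
  have l: "leader u' v' i = leader u v i" if "i \<le> m" for i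
    using that by (intro leader_cong) (simp add: u'_def v'_def)
  have img: "?l ` {..<n} = {..<n} - u ` {..<m}" using leader_image[OF uv] by simp
  have "?l x \<in> {..<n} - u ` {..<m}" "?l y \<in> {..<n} - u ` {..<m}"
    using xy img by blast+
  moreover have Diff_atMost: "{..m} - {m} = {..<m}" by auto
  moreover have "?l x \<noteq> ?l y"
    using ker xy unfolding same_kernel_def by simp
  ultimately have "merges n (Suc m) u' v'"
    using uv by (auto simp: merges_def u'_def v'_def less_Suc_eq Diff_atMost)
  moreover have "S ! Suc m = quotient_trigraph {..<n} a (merge (h x) (h y) w h)"
    unfolding S h using xy w a_sym by (intro contract_quotient) auto
  moreover have "same_kernel {..<n} (merge (h x) (h y) w h) (leader u' v' (Suc m))"
    using same_kernel_merge[OF ker, of x y w "?l y"] xy w l[of m]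
    by (simp add: u'_def v'_def)
  ultimately show ?case using IH l by (metis le_Suc_eq)
qed

lemma merges_of_d_sequence:
  assumes "d_sequence d G S"
  shows "\<exists>u v. merges n (n - 1) u v \<and> red_bounded n a d u v"
proof -
  have S: "S \<noteq> []" "length S = n" "S ! 0 = trigraph_of_graph G"
    "\<And>i. Suc i < n \<Longrightarrow> contraction (S ! i) (S ! Suc i)"
    "\<And>T p. T \<in> set S \<Longrightarrow> p \<in> tverts T \<Longrightarrow> card (red_nbrs T p) \<le> d"
    using assms n_card by (auto simp: d_sequence_def hd_conv_nth)
  obtain u v where uv: "merges n (n - 1) u v" and ex: "\<And>i. i \<le> n - 1 \<Longrightarrow>
      \<exists>h. S ! i = quotient_trigraph {..<n} a h \<and> same_kernel {..<n} h (leader u v i)"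
    using merges_of_contractions[OF S(3), of "n - 1"] S(4) by auto
  have "card (red_nbrs (quotient_trigraph {..<n} a (leader u v i)) (leader u v i x)) \<le> d"
    if "i < n" "x < n" for i x
  proof -
    obtain h where h: "S ! i = quotient_trigraph {..<n} a h" "same_kernel {..<n} h (leader u v i)"
      using ex[of i] \<open>i < n\<close> by fastforce
    have "S ! i \<in> set S" "h x \<in> tverts (S ! i)"
      using S(2) that nth_mem[of i S] by (simp_all add: h(1) quotient_trigraph_def)
    then have "card (red_nbrs (S ! i) (h x)) \<le> d" by (rule S(5))
    then show ?thesis using same_kernel_red_degree[OF h(2), of x a] h(1) that by simp
  qed
  then show ?thesis using uv by (auto simp: red_bounded_def)
qed

text \<open>A contraction needs a fresh vertex, whereas a leader is an old one; hence the detour through the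
  maps \<open>h i\<close> with the same kernels as the leader maps.\<close>

lemma d_sequence_of_merges:
  assumes uv: "merges n (n - 1) u v" and red: "red_bounded n a d u v"
  shows "\<exists>S. d_sequence d G S"
proof -
  \<comment> \<open>\<open>M\<close> exceeds all vertices of \<open>G\<close>, so
    \<open>M + i\<close> is a fresh name at step \<open>i\<close>.\<close>
  define M where "M = Suc (Max (pverts G))"
  define h where "h = rec_nat ((!) vs) (\<lambda>i f. merge (f (u i)) (f (v i)) (M + i) f)"
  have h: "h 0 = (!) vs" "h (Suc i) = merge (h i (u i)) (h i (v i)) (M + i) (h i)" for i
    by (simp_all add: h_def)
  have "finite (pverts G)" using vs(2) by (metis List.finite_set)
  then have h0: "h 0 x < M" if "x < n" for x
    using that vs(2) Max_ge[of "pverts G" "vs ! x"] nth_mem[of x vs]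
    by (simp add: h M_def n_def less_Suc_eq_le)
  have fresh: "h i x < M + i" if "x < n" for i x
    by (induction i) (use that h0 in \<open>auto simp: h(2) merge_def less_Suc_eq\<close>)
  have uvi: "u i < n" "v i < n" "leader u v i (u i) = u i" "leader u v i (v i) = v i" "u i \<noteq> v i"
    if "Suc i < n" for i
    using mergesD[OF uv, of i] that by (simp_all add: leader_fixed)
  have ker: "same_kernel {..<n} (h i) (leader u v i)" if "i < n" for i
    using that
  proof (induction i)
    case 0
    show ?case using initial_kernel h(1) by simp
  next
    case (Suc i)
    have "M + i \<notin> h i ` {..<n}" using fresh[of _ i] by force
    then show ?case
      using same_kernel_merge[of "{..<n}" "h i" "leader u v i" "u i" "v i" "M + i" "v i"]
        Suc uvi[of i] by (simp add: h(2))
  qed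
  define S where "S = map (\<lambda>i. quotient_trigraph {..<n} a (h i)) [0..<n]"
  have Si: "S ! i = quotient_trigraph {..<n} a (h i)" if "i < n" for i
    using that by (simp add: S_def)
  have tv: "tverts (quotient_trigraph {..<n} a f) = f ` {..<n}" for f :: "nat \<Rightarrow> nat"
    by (simp add: quotient_trigraph_def)
  have len: "length S = n" by (simp add: S_def)
  have "contraction (S ! i) (S ! Suc i)" if i: "Suc i < n" for i
  proof -
    have "h i (u i) \<noteq> h i (v i)"
      using ker[of i] uvi[OF i] i unfolding same_kernel_def by simp
    moreover have "M + i \<notin> h i ` {..<n}" using fresh[of _ i] by force
    ultimately have "S ! Suc i = contract (S ! i) (h i (u i)) (h i (v i)) (M + i)"
      using contract_quotient[of "h i (u i)" "h i" "{..<n}" "h i (v i)" "M + i" a] uvi[OF i] a_sym i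
      by (simp add: Si h(2))
    then show ?thesis
      unfolding contraction_def using \<open>h i (u i) \<noteq> h i (v i)\<close> \<open>M + i \<notin> h i ` {..<n}\<close> uvi[OF i] i
      by (intro exI[of _ "h i (u i)"] exI[of _ "h i (v i)"] exI[of _ "M + i"]) (simp add: Si tv)
  qed
  moreover have "card (tverts (last S)) = 1"
  proof -
    have "last S = quotient_trigraph {..<n} a (h (n - 1))"
      using n_pos len Si last_conv_nth[of S] by fastforce
    moreover have "card (h (n - 1) ` {..<n}) = card (leader u v (n - 1) ` {..<n})"
      using same_kernel_card[OF ker] n_pos by simp
    moreover have "leader u v (n - 1) ` {..<n} = {..<n} - u ` {..<n - 1}"
      using leader_image[OF uv] by simp
    \<comment> \<open>No \<open>u i\<close> repeats an earlier one, so exactly one of the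
      \<open>n\<close> leaders survives.\<close>
    moreover have "inj_on u {..<n - 1}"
      using mergesD(3)[OF uv] by (intro linorder_inj_onI') (metis imageI lessThan_iff)
    then have "card (u ` {..<n - 1}) = n - 1" by (simp add: card_image)
    moreover have "u ` {..<n - 1} \<subseteq> {..<n}" using uv by (auto simp: merges_def)
    ultimately show ?thesis using n_pos by (simp add: tv card_Diff_subset)
  qed
  moreover have "card (red_nbrs T p) \<le> d" if T: "T \<in> set S" and p: "p \<in> tverts T" for T p
  proof -
    obtain i where i: "i < n" "T = quotient_trigraph {..<n} a (h i)" using T by (auto simp: S_def)
    then obtain x where x: "x < n" "p = h i x" using p tv by auto
    show ?thesis
      using same_kernel_red_degree[OF ker[OF i(1)], of x a] red i x by (simp add: red_bounded_def)
  qed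
  moreover have "S \<noteq> []" using n_pos len by auto
  moreover from this have "hd S = trigraph_of_graph G"
    using n_pos Si[of 0] initial h(1) by (simp add: hd_conv_nth)
  ultimately have "d_sequence d G S" using len n_card by (simp add: d_sequence_def)
  then show ?thesis ..
qed

lemma tww_le_iff: "tww G \<le> d \<longleftrightarrow> (\<exists>u v. merges n (n - 1) u v \<and> red_bounded n a d u v)"
proof
  \<comment> \<open>\<open>LEAST\<close> is informative only once some sequence exists: merging
    \<open>0\<close>, \<open>1\<close>, ... in turn into \<open>n - 1\<close> gives one, with the
    trivial degree bound \<open>n\<close>.\<close>
  have "card (f ` {y \<in> {..<n}. P y}) \<le> n" for f :: "nat \<Rightarrow> nat" and P
    using card_image_le[of "{y \<in> {..<n}. P y}" f] card_mono[of "{..<n}" "{y \<in> {..<n}. P y}"]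
    by fastforce
  then have "red_bounded n a n u v" for u v
    unfolding red_bounded_def red_nbrs_quotient_image by simp
  moreover have "merges n (n - 1) (\<lambda>i. i) (\<lambda>_. n - 1)" by (auto simp: merges_def)
  ultimately have "\<exists>S. d_sequence n G S" using d_sequence_of_merges by blast
  then have "\<exists>S. d_sequence (tww G) G S" unfolding tww_def by (rule LeastI)
  moreover assume "tww G \<le> d"
  ultimately have "\<exists>S. d_sequence d G S" unfolding d_sequence_def using le_trans by blast
  then show "\<exists>u v. merges n (n - 1) u v \<and> red_bounded n a d u v"
    using merges_of_d_sequence by blast
next
  assume "\<exists>u v. merges n (n - 1) u v \<and> red_bounded n a d u v"
  then have "\<exists>S. d_sequence d G S" using d_sequence_of_merges by blast
  then show "tww G \<le> d" unfolding tww_def by (rule Least_le)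
qed

end

section \<open>The formula\<close>

text \<open>\<open>U i u\<close> and \<open>V i v\<close>: step \<open>i\<close> merges the part of \<open>u\<close> into that of \<open>v\<close>; \<open>L i x p\<close>: before step \<open>i\<close>
  the leader of \<open>x\<close> is \<open>p\<close>; \<open>S i p q k\<close>: among the red neighbours of \<open>p\<close>, \<open>q\<close> has slot \<open>k\<close>.\<close>

definition encodes where
  "encodes n d a U V L S \<longleftrightarrow>
     (\<forall>x<n. L 0 x x) \<and>
     (\<forall>i<n. Suc i < n \<longrightarrow>
       (\<exists>u<n. U i u) \<and> (\<exists>v<n. V i v) \<and>
       (\<forall>j<n. \<forall>u<n. (j < i \<longrightarrow> \<not> U j u \<or> \<not> U i u) \<and> (j \<le> i \<longrightarrow> \<not> U j u \<or> \<not> V i u)) \<and>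
       (\<forall>x<n. \<forall>u<n. \<forall>v<n.
          (\<not> L i x u \<or> \<not> U i u \<or> \<not> V i v \<or> L (Suc i) x v) \<and>
          (v \<noteq> u \<longrightarrow> \<not> L i x v \<or> \<not> U i u \<or> L (Suc i) x v))) \<and>
     (\<forall>i<n. \<forall>p<n. \<forall>q<n. p \<noteq> q \<longrightarrow>
       (\<forall>x<n. \<forall>x'<n. \<forall>y<n. \<forall>y'<n. a x y \<and> \<not> a x' y' \<longrightarrow>
          \<not> L i x p \<or> \<not> L i x' p \<or> \<not> L i y q \<or> \<not> L i y' q \<or> (\<exists>k<d. S i p q k))) \<and>
     (\<forall>i<n. \<forall>p<n. \<forall>q<n. \<forall>q'<n. q \<noteq> q' \<longrightarrow>
       (\<forall>k<d. \<not> S i p q k \<or> \<not> S i p q' k))"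
  for n d :: nat and a U V :: "nat \<Rightarrow> nat \<Rightarrow> bool" and L :: "nat \<Rightarrow> nat \<Rightarrow> nat \<Rightarrow> bool"
    and S :: "nat \<Rightarrow> nat \<Rightarrow> nat \<Rightarrow> nat \<Rightarrow> bool"

text \<open>The four witnesses are those over which the slot clauses of \<open>encodes\<close>
  range.\<close>

lemma red_nbrs_quotient_lessThan:
  "q \<in> red_nbrs (quotient_trigraph {..<n} a h) p \<longleftrightarrow> p \<noteq> q \<and>
     (\<exists>x<n. \<exists>x'<n. \<exists>y<n. \<exists>y'<n. h x = p \<and> h x' = p \<and> h y = q \<and> h y' = q \<and> a x y \<and> \<not> a x' y')"
  unfolding red_nbrs_quotient meets_def mem_Collect_eq by blast

lemma leader_less: "merges n m u v \<Longrightarrow> i \<le> m \<Longrightarrow> x < n \<Longrightarrow> leader u v i x < n"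
  using leader_image[of n m u v i] by blast

text \<open>One true \<open>U\<close> and one true \<open>V\<close> are selected per step.
  \<open>L\<close> then contains the resulting leaders, so every red edge triggers its slot clause,
  and distinct slots bound the red degree by \<open>d\<close>.\<close>

lemma merges_of_encodes:
  assumes "encodes n d a U V L S"
  shows "\<exists>u v. merges n (n - 1) u v \<and> red_bounded n a d u v"
proof -
  have "\<forall>i. \<exists>u v. Suc i < n \<longrightarrow> u < n \<and> v < n \<and> U i u \<and> V i v"
    using assms unfolding encodes_def by (meson Suc_lessD)
  then obtain u v where uv: "\<And>i. Suc i < n \<Longrightarrow> u i < n \<and> v i < n \<and> U i (u i) \<and> V i (v i)"
    by metis
  note merging = assms[unfolded encodes_def, THEN conjunct2, THEN conjunct1, rule_format,
      OF Suc_lessD, THEN conjunct2, THEN conjunct2]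
  have dead: "(j < i \<longrightarrow> \<not> U j p \<or> \<not> U i p) \<and> (j \<le> i \<longrightarrow> \<not> U j p \<or> \<not> V i p)"
    if "Suc i < n" "j < n" "p < n" for i j p
    using merging[OF that(1,1), THEN conjunct1, rule_format, OF that(2,3)] .
  have step: "(L i x p \<and> U i p \<and> V i q \<longrightarrow> L (Suc i) x q) \<and>
      (q \<noteq> p \<and> L i x q \<and> U i p \<longrightarrow> L (Suc i) x q)"
    if "Suc i < n" "x < n" "p < n" "q < n" for i x p q
    using merging[OF that(1,1), THEN conjunct2, rule_format, OF that(2-4)] by blast
  have slot: "\<exists>k<d. S i p q k"
    if "i < n" "p < n" "q < n" "p \<noteq> q" "x < n" "x' < n" "y < n" "y' < n" "a x y" "\<not> a x' y'"
      "L i x p" "L i x' p" "L i y q" "L i y' q" for i p q x x' y y'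
    using assms[unfolded encodes_def, THEN conjunct2, THEN conjunct2, THEN conjunct1, rule_format,
        OF that(1-8) conjI[OF that(9,10)]] that(11-14)
    by blast
  have slot_inj: "\<not> S i p q k \<or> \<not> S i p q' k"
    if "i < n" "p < n" "q < n" "q' < n" "q \<noteq> q'" "k < d" for i p q q' k
    using assms[unfolded encodes_def, THEN conjunct2, THEN conjunct2, THEN conjunct2, rule_format,
        OF that] .
  have "merges n (n - 1) u v"
    unfolding merges_def
  proof (intro allI impI conjI)
    fix i assume "i < n - 1"
    then have i: "Suc i < n" by simp
    show "u i < n" "v i < n" using uv[OF i] by simp_all
    show "u i \<notin> u ` {..<i}"
    proof
      assume "u i \<in> u ` {..<i}"
      then obtain j where "j < i" "u j = u i" by auto
      then show False using dead[OF i, of j "u i"] uv[OF i] uv[of j] i by simp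
    qed
    show "v i \<notin> u ` {..i}"
    proof
      assume "v i \<in> u ` {..i}"
      then obtain j where "j \<le> i" "u j = v i" by auto
      then show False using dead[OF i, of j "v i"] uv[OF i] uv[of j] i by simp
    qed
  qed
  note uv_merges = this
  have L: "L i x (leader u v i x)" if "i < n" "x < n" for i x
    using that(1)
  proof (induction i)
    case 0
    then show ?case using assms that by (simp add: encodes_def)
  next
    case (Suc i)
    let ?l = "leader u v i x"
    have "?l < n" using leader_less[OF uv_merges] Suc.prems that(2) by simp
    \<comment> \<open>The first instance moves the part of \<open>u i\<close> to \<open>v i\<close>;
      the second keeps the leader of every other part.\<close>
    then show ?case
      using step[of i x "u i" "v i"] step[of i x "u i" ?l] uv[OF Suc.prems] Suc that(2)
      by (auto simp: merge_def)
  qed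
  have "card (red_nbrs (quotient_trigraph {..<n} a (leader u v i)) (leader u v i x)) \<le> d"
    if i: "i < n" and x: "x < n" for i x
  proof -
    let ?p = "leader u v i x" and ?R = "red_nbrs (quotient_trigraph {..<n} a (leader u v i)) (leader u v i x)"
    have lt: "leader u v i y < n" if "y < n" for y
      using leader_less[OF uv_merges _ that] i by simp
    have ex: "\<exists>k<d. S i ?p q k" "q < n" if q: "q \<in> ?R" for q
    proof -
      obtain x1 x2 y1 y2 where *: "?p \<noteq> q" "x1 < n" "x2 < n" "y1 < n" "y2 < n"
        "leader u v i x1 = ?p" "leader u v i x2 = ?p" "leader u v i y1 = q" "leader u v i y2 = q"
        "a x1 y1" "\<not> a x2 y2"
        using q unfolding red_nbrs_quotient_lessThan by blast
      show "q < n" using lt *(4,8) by blast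
      have "L i x1 ?p" "L i x2 ?p" "L i y1 q" "L i y2 q"
        using L[OF i *(2)] L[OF i *(3)] L[OF i *(4)] L[OF i *(5)] * by simp_all
      then show "\<exists>k<d. S i ?p q k"
        using slot[OF i lt[OF x] \<open>q < n\<close> *(1-5,10,11)] by blast
    qed
    \<comment> \<open>\<open>f\<close> picks a slot for each red neighbour; the exclusion clauses
      make it injective into \<open>{..<d}\<close>.\<close>
    then obtain f where f: "\<And>q. q \<in> ?R \<Longrightarrow> f q < d \<and> S i ?p q (f q)" by metis
    have "q = q'" if "q \<in> ?R" "q' \<in> ?R" "f q = f q'" for q q'
    proof (rule ccontr)
      assume "q \<noteq> q'"
      then have "\<not> S i ?p q (f q) \<or> \<not> S i ?p q' (f q)"
        using slot_inj[OF i lt[OF x] ex(2)[OF that(1)] ex(2)[OF that(2)]] f[OF that(1)] by blast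
      then show False using f[OF that(1)] f[OF that(2)] that(3) by simp
    qed
    then have "inj_on f ?R" by (auto intro: inj_onI)
    then show ?thesis using card_inj_on_le[of f ?R "{..<d}"] f by auto
  qed
  then show ?thesis using uv_merges by (auto simp: red_bounded_def)
qed

text \<open>The intended assignment takes \<open>U\<close>, \<open>V\<close> and \<open>L\<close>
  exactly; the degree bound supplies an injection of each red neighbourhood into the
  \<open>d\<close> slots.\<close>

lemma encodes_of_merges:
  assumes uv: "merges n (n - 1) u v" and red: "red_bounded n a d u v"
  shows "\<exists>U V L S. encodes n d a U V L S"
proof -
  let ?R = "\<lambda>i p. red_nbrs (quotient_trigraph {..<n} a (leader u v i)) p"
  have fin: "finite (?R i p)" for i p by (simp add: red_nbrs_quotient_image)
  have "\<exists>f. i < n \<and> p \<in> leader u v i ` {..<n} \<longrightarrow> inj_on f (?R i p) \<and> f ` ?R i p \<subseteq> {..<d}" for i p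
    using red card_le_inj[OF fin, of "{..<d}" i p] by (fastforce simp: red_bounded_def)
  then obtain f where f: "\<And>i p. i < n \<Longrightarrow> p \<in> leader u v i ` {..<n} \<Longrightarrow>
      inj_on (f i p) (?R i p) \<and> f i p ` ?R i p \<subseteq> {..<d}"
    by metis
  \<comment> \<open>Requiring \<open>p\<close> to be a current leader makes \<open>S\<close> false
    where \<open>f i p\<close> is unspecified.\<close>
  define S where "S i p q k \<longleftrightarrow> p \<in> leader u v i ` {..<n} \<and> q \<in> ?R i p \<and> f i p q = k" for i p q k
  have ui: "u i < n" "v i < n" "\<And>j. j < i \<Longrightarrow> u j \<noteq> u i" "\<And>j. j \<le> i \<Longrightarrow> u j \<noteq> v i"
    if "Suc i < n" for i
  proof -
    have i: "i < n - 1" using that by simp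
    note m = mergesD[OF uv i]
    show "u i < n" "v i < n" by (fact m)+
    show "u j \<noteq> u i" if "j < i" for j using m(3) that by (metis imageI lessThan_iff)
    show "u j \<noteq> v i" if "j \<le> i" for j
      using m(4,5) that by (metis imageI lessThan_iff le_neq_implies_less)
  qed
  have E: "\<exists>k<d. S i p q k"
    if "i < n" "p \<noteq> q" "x < n" "x' < n" "y < n" "y' < n" "a x y" "\<not> a x' y'"
      "leader u v i x = p" "leader u v i x' = p" "leader u v i y = q" "leader u v i y' = q"
    for i p q x x' y y'
  proof -
    have "p \<in> leader u v i ` {..<n}" using that by blast
    moreover have "q \<in> ?R i p" unfolding red_nbrs_quotient_lessThan using that by blast
    ultimately show ?thesis using f[of i p] that(1) unfolding S_def by blast
  qed
  have I: "\<not> S i p q k \<or> \<not> S i p q' k" if "i < n" "q \<noteq> q'" for i p q q' k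
    using f[OF that(1), of p] that(2) unfolding S_def by (metis inj_onD)
  have "encodes n d a (\<lambda>i w. w = u i) (\<lambda>i w. w = v i) (\<lambda>i x p. p = leader u v i x) S"
    unfolding encodes_def
  proof (intro conjI allI impI)
    fix i x x' y y' p q :: nat
    assume "i < n" "p \<noteq> q" "x < n" "x' < n" "y < n" "y' < n" "a x y \<and> \<not> a x' y'"
    then show "p \<noteq> leader u v i x \<or> p \<noteq> leader u v i x' \<or> q \<noteq> leader u v i y \<or>
        q \<noteq> leader u v i y' \<or> (\<exists>k<d. S i p q k)"
      using E by metis
  qed (use ui I in \<open>auto simp: merge_def\<close>)
  then show ?thesis by blast
qed

lemma ex_encodes_iff:
  "(\<exists>U V L S. encodes n d a U V L S) \<longleftrightarrow> (\<exists>u v. merges n (n - 1) u v \<and> red_bounded n a d u v)"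
proof
  assume "\<exists>U V L S. encodes n d a U V L S"
  then obtain U V L S where "encodes n d a U V L S" by blast
  then show "\<exists>u v. merges n (n - 1) u v \<and> red_bounded n a d u v" by (rule merges_of_encodes)
next
  assume "\<exists>u v. merges n (n - 1) u v \<and> red_bounded n a d u v"
  then obtain u v where "merges n (n - 1) u v" "red_bounded n a d u v" by blast
  then show "\<exists>U V L S. encodes n d a U V L S" by (rule encodes_of_merges)
qed

text \<open>Only the leading digit \<open>t\<close> may exceed the base \<open>n\<close>. It tells the families of variables apart.\<close>

definition idx :: "nat \<Rightarrow> nat \<Rightarrow> nat \<Rightarrow> nat \<Rightarrow> nat \<Rightarrow> nat" where
  "idx n t i x p = ((t * n + i) * n + x) * n + p"

lemma idx_decode:
  assumes "i < n" "x < n" "p < n"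
  shows "idx n t i x p mod n = p" "idx n t i x p div n mod n = x"
    "idx n t i x p div n div n mod n = i" "idx n t i x p div n div n div n = t"
  using assms by (simp_all add: idx_def)

section \<open>From the encoding to clauses\<close>

abbreviation each :: "nat \<Rightarrow> (nat \<Rightarrow> 'a list) \<Rightarrow> 'a list" where
  "each n f \<equiv> concat (map f [0..<n])"

text \<open>The lists follow \<open>encodes\<close> conjunct by conjunct. The slot \<open>k\<close>
  goes into the leading digit because \<open>d\<close> may exceed \<open>n\<close>.\<close>

definition tww_formula :: "nat \<Rightarrow> nat \<Rightarrow> (nat \<Rightarrow> nat \<Rightarrow> bool) \<Rightarrow> cnf" where
  "tww_formula n d a =
    (let U = \<lambda>i u. idx n 0 i u 0; V = \<lambda>i v. idx n 1 i v 0; L = \<lambda>i x p. idx n 2 i x p;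
         S = \<lambda>i p q k. idx n (3 + k) i p q
     in
     each n (\<lambda>x. [[Pos (L 0 x x)]]) @
     each n (\<lambda>i. if Suc i < n then
       [map (\<lambda>u. Pos (U i u)) [0..<n]] @ [map (\<lambda>v. Pos (V i v)) [0..<n]] @
       each n (\<lambda>j. each n (\<lambda>u.
         (if j < i then [[Neg (U j u), Neg (U i u)]] else []) @
         (if j \<le> i then [[Neg (U j u), Neg (V i u)]] else []))) @
       each n (\<lambda>x. each n (\<lambda>u. each n (\<lambda>v.
         [[Neg (L i x u), Neg (U i u), Neg (V i v), Pos (L (Suc i) x v)]] @
         (if v \<noteq> u then [[Neg (L i x v), Neg (U i u), Pos (L (Suc i) x v)]] else []))))
       else []) @
     each n (\<lambda>i. each n (\<lambda>p. each n (\<lambda>q. if p \<noteq> q then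
       each n (\<lambda>x. each n (\<lambda>x'. each n (\<lambda>y. each n (\<lambda>y'. if a x y \<and> \<not> a x' y' then
         [[Neg (L i x p), Neg (L i x' p), Neg (L i y q), Neg (L i y' q)] @
          map (\<lambda>k. Pos (S i p q k)) [0..<d]]
         else []))))
       else []))) @
     each n (\<lambda>i. each n (\<lambda>p. each n (\<lambda>q. each n (\<lambda>q'. if q \<noteq> q' then
       each d (\<lambda>k. [[Neg (S i p q k), Neg (S i p q' k)]])
       else [])))))"

lemma Ball_set_each: "(\<forall>C \<in> set (each n f). P C) \<longleftrightarrow> (\<forall>i<n. \<forall>C \<in> set (f i). P C)"
  by auto

lemma Ball_set_append: "(\<forall>C \<in> set (xs @ ys). P C) \<longleftrightarrow> (\<forall>C \<in> set xs. P C) \<and> (\<forall>C \<in> set ys. P C)"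
  by auto

lemma Ball_set_if: "(\<forall>C \<in> set (if b then xs else []). P C) \<longleftrightarrow> (b \<longrightarrow> (\<forall>C \<in> set xs. P C))"
  by auto

lemma Ball_set_single: "(\<forall>C \<in> set [D]. P C) \<longleftrightarrow> P D"
  by auto

lemma Bex_set_map: "(\<exists>l \<in> set (map f [0..<n]). P l) \<longleftrightarrow> (\<exists>i<n. P (f i))"
  by auto

lemma Bex_set_Cons: "(\<exists>l \<in> set (x # xs). P l) \<longleftrightarrow> P x \<or> (\<exists>l \<in> set xs. P l)"
  by auto

lemma Bex_set_append: "(\<exists>l \<in> set (xs @ ys). P l) \<longleftrightarrow> (\<exists>l \<in> set xs. P l) \<or> (\<exists>l \<in> set ys. P l)"
  by auto

lemma Bex_set_Nil: "(\<exists>l \<in> set []. P l) \<longleftrightarrow> False"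
  by auto

text \<open>Quantifiers over clauses and literals become the bounded quantifiers of
  \<open>encodes\<close>; up to associativity both sides then coincide.\<close>

lemma tww_formula_holds:
  "(\<forall>C \<in> set (tww_formula n d a). \<exists>l \<in> set C. lit_holds \<alpha> l) \<longleftrightarrow>
   encodes n d a (\<lambda>i u. \<alpha> (idx n 0 i u 0)) (\<lambda>i v. \<alpha> (idx n 1 i v 0))
     (\<lambda>i x p. \<alpha> (idx n 2 i x p)) (\<lambda>i p q k. \<alpha> (idx n (3 + k) i p q))"
  unfolding tww_formula_def Let_def encodes_def Ball_set_each Ball_set_append Ball_set_if
    Ball_set_single Bex_set_map Bex_set_Cons Bex_set_append Bex_set_Nil lit_holds.simps
    simp_thms conj_assoc disj_assoc
  ..

text \<open>Only arguments in range are queried. This serves the variable numbering, which can be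
  decoded only in range, and the exchange of the adjacency read from memory for that of the
  graph.\<close>

lemma encodes_cong:
  assumes "encodes n d a U V L S"
    and "\<And>i u. i < n \<Longrightarrow> u < n \<Longrightarrow> U i u = U' i u" "\<And>i v. i < n \<Longrightarrow> v < n \<Longrightarrow> V i v = V' i v"
    and "\<And>i x p. i < n \<Longrightarrow> x < n \<Longrightarrow> p < n \<Longrightarrow> L i x p = L' i x p"
    and "\<And>i p q k. i < n \<Longrightarrow> p < n \<Longrightarrow> q < n \<Longrightarrow> k < d \<Longrightarrow> S i p q k = S' i p q k"
    and "\<And>x y. x < n \<Longrightarrow> y < n \<Longrightarrow> a x y = a' x y"
  shows "encodes n d a' U' V' L' S'"
proof -
  have "encodes n d a U V L S \<longleftrightarrow> encodes n d a' U' V' L' S'"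
    unfolding encodes_def by (simp only: assms(2-6) cong: conj_cong imp_cong)
  with assms(1) show ?thesis by (rule iffD1[rotated])
qed

lemma satisfiable_tww_formula:
  "satisfiable (tww_formula n d a) \<longleftrightarrow> (\<exists>U V L S. encodes n d a U V L S)"
proof
  assume "satisfiable (tww_formula n d a)"
  then show "\<exists>U V L S. encodes n d a U V L S"
    unfolding satisfiable_def tww_formula_holds by blast
next
  assume "\<exists>U V L S. encodes n d a U V L S"
  then obtain U V L S where e: "encodes n d a U V L S" by blast
  \<comment> \<open>A variable number is decoded into its base-\<open>n\<close> digits, and the
    leading digit selects the family to be asked.\<close>
  define \<phi> where "\<phi> t i x p = (if t = 0 then U i x else if t = 1 then V i x
      else if t = 2 then L i x p else S i x p (t - 3))" for t i x p
  define \<alpha> where "\<alpha> v = \<phi> (v div n div n div n) (v div n div n mod n) (v div n mod n) (v mod n)" for v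
  have \<alpha>: "\<alpha> (idx n t i x p) = \<phi> t i x p" if "i < n" "x < n" "p < n" for t i x p
    unfolding \<alpha>_def idx_decode[OF that] by (rule refl)
  have "encodes n d a (\<lambda>i u. \<alpha> (idx n 0 i u 0)) (\<lambda>i v. \<alpha> (idx n 1 i v 0))
     (\<lambda>i x p. \<alpha> (idx n 2 i x p)) (\<lambda>i p q k. \<alpha> (idx n (3 + k) i p q))"
    by (rule encodes_cong[OF e]) (simp_all add: \<alpha> \<phi>_def)
  then show "satisfiable (tww_formula n d a)"
    unfolding satisfiable_def tww_formula_holds[symmetric] by blast
qed

section \<open>The program\<close>

text \<open>Horner's scheme for \<open>idx\<close>, one multiplication per scratch register; the
  added one and the sign belong to the output format.\<close>

definition lit_gen :: "bool \<Rightarrow> aexp \<Rightarrow> aexp \<Rightarrow> aexp \<Rightarrow> aexp \<Rightarrow> gen" where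
  "lit_gen b t i x p =
     (let e = Add (Add (Reg ''c'') p) (Const 1) in
      Mul ''a'' t (Mul ''b'' (Add (Reg ''a'') i) (Mul ''c'' (Add (Reg ''b'') x)
        (Out (if b then e else Sub (Const 0) e)))))"

abbreviation loop :: "string \<Rightarrow> gen \<Rightarrow> gen" where "loop x \<equiv> For x 0"
abbreviation stop :: gen where "stop \<equiv> Out (Const 0)"

text \<open>The initial lone \<open>stop\<close> prints the empty clause when \<open>d\<close> is
  negative. Registers \<open>e\<close> and \<open>f\<close> hold row offsets into the matrix, which
  starts at cell \<open>2\<close>.\<close>

definition tww_gen :: gen where
  "tww_gen =
    (let i = Reg ''i''; j = Reg ''j''; u = Reg ''u''; v = Reg ''v''; p = Reg ''p''; q = Reg ''q'';
         q' = Reg ''r''; x = Reg ''x''; x' = Reg ''s''; y = Reg ''y''; y' = Reg ''t''; k = Reg ''k'';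
         next_i = Add i (Const 1); n = Mem (Const 0);
         U = \<lambda>b i u. lit_gen b (Const 0) i u (Const 0);
         V = \<lambda>b i v. lit_gen b (Const 1) i v (Const 0);
         L = \<lambda>b i x p. lit_gen b (Const 2) i x p;
         S = \<lambda>b i p q k. lit_gen b (Add (Const 3) k) i p q
     in
     When (Less (Mem (Const 1)) (Const 0)) stop ;;
     loop ''x'' (L True (Const 0) x x ;; stop) ;;
     loop ''i'' (When (Less next_i n)
       (loop ''u'' (U True i u) ;; stop ;;
        loop ''v'' (V True i v) ;; stop ;;
        loop ''j'' (loop ''u''
          (When (Less j i) (U False j u ;; U False i u ;; stop) ;;
           When (Not (Less i j)) (U False j u ;; V False i u ;; stop))) ;;
        loop ''x'' (loop ''u'' (loop ''v''
          (L False i x u ;; U False i u ;; V False i v ;; L True next_i x v ;; stop ;;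
           When (Not (Equal v u)) (L False i x v ;; U False i u ;; L True next_i x v ;; stop)))))) ;;
     loop ''i'' (loop ''p'' (loop ''q'' (When (Not (Equal p q))
       (loop ''x'' (loop ''s'' (loop ''y'' (loop ''t'' (Mul ''e'' x (Mul ''f'' x'
         (When (And (Equal (Mem (Add (Add (Const 2) (Reg ''e'')) y)) (Const 1))
                    (Not (Equal (Mem (Add (Add (Const 2) (Reg ''f'')) y')) (Const 1))))
           (L False i x p ;; L False i x' p ;; L False i y q ;; L False i y' q ;;
            For ''k'' 1 (S True i p q k) ;; stop))))))))))) ;;
     loop ''i'' (loop ''p'' (loop ''q'' (loop ''r'' (When (Not (Equal q q'))
       (For ''k'' 1 (S False i p q k ;; S False i p q' k ;; stop)))))))"

lemma well_scoped_tww_gen: "well_scoped {} tww_gen"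
  by (simp add: tww_gen_def lit_gen_def Let_def)

section \<open>The printed formula\<close>

lemma dimacs_simps:
  "dimacs [] = []" "dimacs [C] = map lit_code C @ [0]" "dimacs (F @ F') = dimacs F @ dimacs F'"
  "dimacs (C # F) = map lit_code C @ 0 # dimacs F"
  "dimacs (if b then F else F') = (if b then dimacs F else dimacs F')"
  "dimacs (map c xs) = concat (map (\<lambda>x. map lit_code (c x) @ [0]) xs)"
  "dimacs (concat (map f xs)) = concat (map (\<lambda>x. dimacs (f x)) xs)"
  for f :: "nat \<Rightarrow> cnf" and c :: "nat \<Rightarrow> literal list"
  by (simp_all add: dimacs_def comp_def) (induction xs; simp)

definition adjacent_in :: "state \<Rightarrow> nat \<Rightarrow> nat \<Rightarrow> nat \<Rightarrow> bool" where
  "adjacent_in s n x y \<longleftrightarrow> mem s (2 + int x * int n + int y) = 1"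

lemma aval_update_reg:
  "(\<And>y. y \<in> aregs a \<Longrightarrow> f y = reg s y) \<Longrightarrow> aval a (s\<lparr>reg := f\<rparr>) = aval a s"
  by (induction a) simp_all

text \<open>\<open>i\<close>, \<open>x\<close> and \<open>p\<close> are evaluated after scratch
  registers have been set and so must avoid them; \<open>t\<close> is evaluated first.\<close>

lemma emitted_lit_gen:
  assumes "mem s 0 = int n" "aval t s = int t'" "aval i s = int i'" "aval x s = int x'" "aval p s = int p'"
    and "{''a'', ''b'', ''c''} \<inter> (aregs i \<union> aregs x \<union> aregs p) = {}"
  shows "emitted (lit_gen b t i x p) s = [lit_code ((if b then Pos else Neg) (idx n t' i' x' p'))]"
proof -
  have "aval e (s\<lparr>reg := (reg s)(''a'' := u)\<rparr>) = aval e s"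
    "aval e (s\<lparr>reg := (reg s)(''a'' := u, ''b'' := v)\<rparr>) = aval e s"
    "aval e (s\<lparr>reg := (reg s)(''a'' := u, ''b'' := v, ''c'' := w)\<rparr>) = aval e s"
    if "{''a'', ''b'', ''c''} \<inter> aregs e = {}" for e u v w
    using that by (auto intro!: aval_update_reg)
  then show ?thesis using assms by (simp add: lit_gen_def Let_def idx_def)
qed

lemma concat_singletons: "concat (map (\<lambda>k. [f k]) xs) = map f xs"
  by (induction xs) simp_all

text \<open>For negative \<open>d\<close> the slot loops are empty, in accordance with
  \<open>nat d = 0\<close>.\<close>

lemma emitted_tww_gen:
  assumes n: "mem s 0 = int n" and d: "mem s 1 = d"
  shows "emitted tww_gen s =
    dimacs ((if d < 0 then [[]] else []) @ tww_formula n (nat d) (adjacent_in s n))"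
proof -
  have int_less: "int i + 1 < int n \<longleftrightarrow> Suc i < n" for i by linarith
  \<comment> \<open>Phrased with \<open>nat\<close> of the values, this rewrites without having to
    guess the natural numbers on the right.\<close>
  have lt: "emitted (lit_gen b t i x p) r = [lit_code ((if b then Pos else Neg) (idx n
      (nat (aval t r)) (nat (aval i r)) (nat (aval x r)) (nat (aval p r))))]"
    if "mem r 0 = int n" "0 \<le> aval t r" "0 \<le> aval i r" "0 \<le> aval x r" "0 \<le> aval p r"
      "{''a'', ''b'', ''c''} \<inter> (aregs i \<union> aregs x \<union> aregs p) = {}" for b t i x p r
    using that by (intro emitted_lit_gen) simp_all
  have sums: "nat (int i + 1) = Suc i" "nat (3 + int i) = 3 + i" for i by simp_all
  show ?thesis
    unfolding tww_gen_def tww_formula_def Let_def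
    by (simp add: lt n d int_less sums dimacs_simps adjacent_in_def concat_singletons comp_def
        map_concat if_distrib[of "map lit_code"] not_less cong: if_cong del: upt_Suc)
qed

section \<open>Reading the input, and the conclusion\<close>

text \<open>Row-major addressing, as in the adjacency matrix of \<open>input_list\<close>.\<close>

lemma rectangle_nth:
  assumes "i < length xs" "j < length ys"
  shows "i * length ys + j < length (concat (map (\<lambda>x. map (f x) ys) xs))"
    and "concat (map (\<lambda>x. map (f x) ys) xs) ! (i * length ys + j) = f (xs ! i) (ys ! j)"
proof -
  have "i * length ys + j < length (concat (map (\<lambda>x. map (f x) ys) xs)) \<and>
      concat (map (\<lambda>x. map (f x) ys) xs) ! (i * length ys + j) = f (xs ! i) (ys ! j)"
    using assms(1)
  proof (induction xs arbitrary: i)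
    case (Cons x xs)
    then show ?case using assms(2) by (cases i) (auto simp: nth_append)
  qed simp
  then show "i * length ys + j < length (concat (map (\<lambda>x. map (f x) ys) xs))"
    and "concat (map (\<lambda>x. map (f x) ys) xs) ! (i * length ys + j) = f (xs ! i) (ys ! j)" by blast+
qed

lemma mem_input_state:
  shows "mem (input_state vs G d) 0 = int (length vs)" and "mem (input_state vs G d) 1 = d"
    and "\<lbrakk>x < length vs; y < length vs\<rbrakk> \<Longrightarrow>
      adjacent_in (input_state vs G d) (length vs) x y \<longleftrightarrow> (vs ! x, vs ! y) \<in> parcs G"
proof -
  show "mem (input_state vs G d) 0 = int (length vs)" "mem (input_state vs G d) 1 = d"
    by (simp_all add: input_state_def input_list_def)
  assume xy: "x < length vs" "y < length vs"
  let ?f = "\<lambda>u v. if (u, v) \<in> parcs G then 1 else 0 :: int" and ?m = "x * length vs + y"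
  have "nat (2 + int x * int (length vs) + int y) = Suc (Suc ?m)"
    by (simp add: nat_add_distrib nat_mult_distrib)
  then have "mem (input_state vs G d) (2 + int x * int (length vs) + int y) = ?f (vs ! x) (vs ! y)"
    using rectangle_nth[OF xy, of ?f]
    unfolding input_state_def input_list_def by (auto simp flip: of_nat_mult of_nat_add)
  then show "adjacent_in (input_state vs G d) (length vs) x y \<longleftrightarrow> (vs ! x, vs ! y) \<in> parcs G"
    by (simp add: adjacent_in_def)
qed

text \<open>\<open>b\<close> stands for the adjacency read from memory, which is compared with
  \<open>a\<close> only at positions below \<open>n\<close>.\<close>

theorem (in enumerated_graph) satisfiable_tww_formula_iff:
  assumes "\<And>x y. x < n \<Longrightarrow> y < n \<Longrightarrow> b x y \<longleftrightarrow> a x y"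
  shows "satisfiable (tww_formula n d b) \<longleftrightarrow> tww G \<le> d"
proof -
  have "(\<exists>U V L S. encodes n d b U V L S) \<longleftrightarrow> (\<exists>U V L S. encodes n d a U V L S)"
    using encodes_cong[OF _ refl refl refl refl, where a = a and a' = b]
      encodes_cong[OF _ refl refl refl refl, where a = b and a' = a] assms by blast
  then show ?thesis
    unfolding satisfiable_tww_formula tww_le_iff by (simp only: ex_encodes_iff)
qed

theorem theorem3:
  shows "\<exists>(prog :: com) (p :: nat poly).
    \<forall>(G :: nat pair_pre_digraph) (vs :: nat list) (d :: int).
      pair_graph G \<and> pverts G \<noteq> {} \<and> distinct vs \<and> set vs = pverts G \<longrightarrow>
      (\<exists>t s F. runs prog (input_state vs G d) t s \<and>
               t \<le> poly p (card (pverts G) + nat \<bar>d\<bar>) \<and>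
               out s = dimacs F \<and>
               (satisfiable F \<longleftrightarrow> int (tww G) \<le> d))"
proof (intro exI[of _ "compile tww_gen"] exI[of _ "time tww_gen"] allI impI)
  fix G :: "nat pair_pre_digraph" and vs :: "nat list" and d :: int
  assume asm: "pair_graph G \<and> pverts G \<noteq> {} \<and> distinct vs \<and> set vs = pverts G"
  interpret enumerated_graph G vs
    using asm by (intro enumerated_graph.intro) simp_all
  let ?s = "input_state vs G d"
  \<comment> \<open>The empty clause makes \<open>F\<close> unsatisfiable for negative
    \<open>d\<close>, as it must be since \<open>tww G\<close> is a natural number.\<close>
  define F where
    "F = (if d < 0 then [[]] else []) @ tww_formula n (nat d) (adjacent_in ?s n)"
  note mem = mem_input_state[where vs = vs and G = G and d = d, folded n_def]
  \<comment> \<open>Both loop bounds are at most the sum of \<open>n\<close> and the absolute value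
    of \<open>d\<close>, the number at which the time polynomial is evaluated.\<close>
  have "nat (mem ?s 0) \<le> card (pverts G) + nat \<bar>d\<bar>" "nat (mem ?s 1) \<le> card (pverts G) + nat \<bar>d\<bar>"
    using mem n_card by simp_all
  then obtain t s where "runs (compile tww_gen) ?s t s"
    "t \<le> poly (time tww_gen) (card (pverts G) + nat \<bar>d\<bar>)" "out s = out ?s @ emitted tww_gen ?s"
    using compile_correct[OF well_scoped_tww_gen] by blast
  moreover have "out ?s @ emitted tww_gen ?s = dimacs F"
    unfolding F_def emitted_tww_gen[OF mem(1,2)] by (simp add: input_state_def)
  moreover have "satisfiable (tww_formula n (nat d) (adjacent_in ?s n)) \<longleftrightarrow> tww G \<le> nat d"
    using satisfiable_tww_formula_iff mem(3) by (simp add: a_def)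
  then have "satisfiable F \<longleftrightarrow> int (tww G) \<le> d"
    unfolding F_def by (cases "d < 0") (auto simp: satisfiable_def le_nat_iff)
  ultimately show "\<exists>t s F. runs (compile tww_gen) ?s t s \<and>
      t \<le> poly (time tww_gen) (card (pverts G) + nat \<bar>d\<bar>) \<and> out s = dimacs F \<and>
      (satisfiable F \<longleftrightarrow> int (tww G) \<le> d)"
    by auto
qed

end
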